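(* Let $x_0>0$ and $\mathcal A_0>\frac32\pi x_0^2$. Let $L=L(x_0,\mathcal A_0)$ be the unique $L>3x_0$ such that the curve $\gamma(x_0,L)$ encloses area $\mathcal A_0$, and put $\gamma=\gamma(x_0,L)$, $\lambda=\lambda(x_0,L)=\frac{2L}{L+x_0}$. Then there exists a constant $\tilde{\mathcal C}=\tilde{\mathcal C}(x_0,\mathcal A_0)>0$ such that: (ii) for every admissible variation $\mathcal V$ of $\gamma$, $$\left.\frac{d^2(\mathcal F-\lambda\mathcal A)(\mathcal V(\cdot,t))}{dt^2}\right|_{t=0}\ \ge\ \tilde{\mathcal C}\,\|\varphi\|^2_{W^{2,2}(0,2L)};$$ in particular $\gamma$ is a stable critical point of $\mathcal F-\lambda\mathcal A$; (iii) for every area-preserving admissible variation $\mathcal V$ of $\gamma$, $$\left.\frac{d^2\mathcal F(\mathcal V(\cdot,t))}{dt^2}\right|_{t=0}\ \ge\ \tilde{\mathcal C}\,\|\varphi\|^2_{W^{2,2}(0,2L)};$$ in particular $\gamma$ is an area-preserving stable critical point of $\mathcal F$. Here $\varphi$ is the normal component of the velocity: $X=\varphi N+\varphi_\tau\dot\gamma$.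
   Context: Notation: for $(\xi,\eta)\in\mathbb R^2$, $(\xi,\eta)^\perp=(\eta,-\xi)$; dots denote $s$-derivatives. For a regular curve $\gamma\in C^2([0,2L],\mathbb R^2)$ (i.e. $|\dot\gamma|>0$) the curvature is $H=\langle\dot\gamma,\ddot\gamma^\perp\rangle/|\dot\gamma|^3$ and the normal is $N=\dot\gamma^\perp/|\dot\gamma|$; $\gamma$ is strictly counterclockwise if $H>0$ on $[0,2L]$. Fix $x_0>0,L>0$. A curve $\gamma=(x,y)$ is admissible if $\gamma\in C^\infty([0,2L],\mathbb R^2)$ is regular, strictly counterclockwise and injective, $\gamma(0)=(x_0,0)$, $\gamma(2L)=(-x_0,0)$, and $y(s)>0$ for $s\in(0,2L)$. Its enclosed area (area of the region bounded by $\gamma$ and the segment $[-x_0,x_0]\times\{0\}$) is $\mathcal A(\gamma)=\frac12\int_0^{2L}(x\dot y-\dot xy)\,ds$, and its total inverse curvature is $\mathcal F(\gamma)=\int_0^{2L}\frac{|\dot\gamma|}{H}\,ds$. An admissible variation of an admissible $\gamma$ is a smooth map $\mathcal V:[0,2L]\times[-t_{\mathcal V},t_{\mathcal V}]\to\mathbb R^2$ ($t_{\mathcal V}>0$) with $\mathcal V(\cdot,0)=\gamma$ and $\gamma_t=\mathcal V(\cdot,t)$ admissible for every $t$; its velocity is $X=\partial_t\mathcal V|_{t=0}$. It is area-preserving if $\mathcal A(\gamma_t)=\mathcal A(\gamma)$ for all $t$. For an arc-length parametrized $\gamma$ write $X=\varphi N+\varphi_\tau\dot\gamma$. The curve $\gamma(x_0,L)$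 (defined for $0<3x_0<L$): with $\sigma=\pi\sqrt{x_0/(L+x_0)}$, $k=L/\sin\sigma$, $a(s)=\arcsin((s-L)/k)$, it is $\gamma(x_0,L)=(x,y)$ on $[0,2L]$ with $x(s)=-\frac k2\Big(\frac{\sigma}{\pi+\sigma}\sin\big(\tfrac{\pi+\sigma}{\sigma}a(s)\big)+\frac{\sigma}{\pi-\sigma}\sin\big(\tfrac{\pi-\sigma}{\sigma}a(s)\big)\Big)$, $y(s)=\frac k2\Big(\frac{\sigma}{\pi+\sigma}\cos\big(\tfrac{\pi+\sigma}{\sigma}a(s)\big)+\frac{\sigma}{\pi-\sigma}\cos\big(\tfrac{\pi-\sigma}{\sigma}a(s)\big)\Big)+\frac{\pi x_0}{\sigma\tan\sigma}$. It is an admissible, arc-length parametrized, vertically symmetric curve with curvature $H(s)=\frac{\pi}{\sigma\sqrt{k^2-(s-L)^2}}$. For every $\mathcal A_0>\frac32\pi x_0^2$ there is a unique $L>3x_0$ with $\mathcal A(\gamma(x_0,L))=\mathcal A_0$. Stability: $\gamma$ is a stable critical point of $\mathcal F-\lambda\mathcal A$ if the second $t$-derivative at $0$ of $(\mathcal F-\lambda\mathcal A)(\mathcal V(\cdot,t))$ is $\ge0$ for every admissible variation; it is an area-preserving stable critical point of $\mathcal F$ if the second derivative of $\mathcal F(\mathcal V(\cdot,t))$ at $0$ is $\ge0$ for every area-preserving admissible variation. *)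

theory Defs
  imports "HOL-Analysis.Analysis"
begin

fun iter_dderiv :: "'a list \<Rightarrow> ('a::real_normed_vector \<Rightarrow> 'b::real_normed_vector) \<Rightarrow> 'a \<Rightarrow> 'b" where
  "iter_dderiv [] f = f"
| "iter_dderiv (v # vs) f = (\<lambda>x. frechet_derivative (iter_dderiv vs f) (at x) v)"

definition C_inf_on :: "'a::real_normed_vector set \<Rightarrow> ('a \<Rightarrow> 'b::real_normed_vector) \<Rightarrow> bool" where
  "C_inf_on S f \<longleftrightarrow> (\<exists>U g. open U \<and> S \<subseteq> U \<and> (\<forall>x\<in>S. g x = f x) \<and>
      (\<forall>vs. \<forall>x\<in>U. iter_dderiv vs g differentiable (at x)))"

definition perp :: "real \<times> real \<Rightarrow> real \<times> real" where
  "perp v = (snd v, - fst v)"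

definition cdot :: "real \<Rightarrow> (real \<Rightarrow> real \<times> real) \<Rightarrow> real \<Rightarrow> real \<times> real" where
  "cdot L \<gamma> s = vector_derivative \<gamma> (at s within {0..2*L})"

definition cddot :: "real \<Rightarrow> (real \<Rightarrow> real \<times> real) \<Rightarrow> real \<Rightarrow> real \<times> real" where
  "cddot L \<gamma> s = vector_derivative (cdot L \<gamma>) (at s within {0..2*L})"

definition curvature :: "real \<Rightarrow> (real \<Rightarrow> real \<times> real) \<Rightarrow> real \<Rightarrow> real" where
  "curvature L \<gamma> s = inner (cdot L \<gamma> s) (perp (cddot L \<gamma> s)) / norm (cdot L \<gamma> s) ^ 3"

definition normal :: "real \<Rightarrow> (real \<Rightarrow> real \<times> real) \<Rightarrow> real \<Rightarrow> real \<times> real" where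
  "normal L \<gamma> s = (1 / norm (cdot L \<gamma> s)) *\<^sub>R perp (cdot L \<gamma> s)"

definition admissible :: "real \<Rightarrow> real \<Rightarrow> (real \<Rightarrow> real \<times> real) \<Rightarrow> bool" where
  "admissible x0 L \<gamma> \<longleftrightarrow>
     C_inf_on {0..2*L} \<gamma> \<and>
     (\<forall>s\<in>{0..2*L}. norm (cdot L \<gamma> s) > 0) \<and>
     (\<forall>s\<in>{0..2*L}. curvature L \<gamma> s > 0) \<and>
     inj_on \<gamma> {0..2*L} \<and>
     \<gamma> 0 = (x0, 0) \<and> \<gamma> (2*L) = (- x0, 0) \<and>
     (\<forall>s\<in>{0<..<2*L}. snd (\<gamma> s) > 0)"

definition area :: "real \<Rightarrow> (real \<Rightarrow> real \<times> real) \<Rightarrow> real" where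
  "area L \<gamma> = 1/2 * integral {0..2*L}
     (\<lambda>s. fst (\<gamma> s) * snd (cdot L \<gamma> s) - fst (cdot L \<gamma> s) * snd (\<gamma> s))"

definition Fcal :: "real \<Rightarrow> (real \<Rightarrow> real \<times> real) \<Rightarrow> real" where
  "Fcal L \<gamma> = integral {0..2*L} (\<lambda>s. norm (cdot L \<gamma> s) / curvature L \<gamma> s)"

definition admissible_variation :: "real \<Rightarrow> real \<Rightarrow> (real \<Rightarrow> real \<times> real) \<Rightarrow> real \<Rightarrow>
    (real \<Rightarrow> real \<Rightarrow> real \<times> real) \<Rightarrow> bool" where
  "admissible_variation x0 L \<gamma> t0 V \<longleftrightarrow>
     t0 > 0 \<and> C_inf_on ({0..2*L} \<times> {-t0..t0}) (\<lambda>p. V (fst p) (snd p)) \<and>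
     (\<forall>s\<in>{0..2*L}. V s 0 = \<gamma> s) \<and>
     (\<forall>t\<in>{-t0..t0}. admissible x0 L (\<lambda>s. V s t))"

definition area_preserving :: "real \<Rightarrow> (real \<Rightarrow> real \<times> real) \<Rightarrow> real \<Rightarrow>
    (real \<Rightarrow> real \<Rightarrow> real \<times> real) \<Rightarrow> bool" where
  "area_preserving L \<gamma> t0 V \<longleftrightarrow> (\<forall>t\<in>{-t0..t0}. area L (\<lambda>s. V s t) = area L \<gamma>)"

definition velocity :: "(real \<Rightarrow> real \<Rightarrow> real \<times> real) \<Rightarrow> real \<Rightarrow> real \<times> real" where
  "velocity V s = vector_derivative (\<lambda>t. V s t) (at 0)"

definition normal_comp :: "real \<Rightarrow> (real \<Rightarrow> real \<times> real) \<Rightarrow> (real \<Rightarrow> real \<Rightarrow> real \<times> real) \<Rightarrow> real \<Rightarrow> real" where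
  "normal_comp L \<gamma> V s = inner (velocity V s) (normal L \<gamma> s)"

definition W22_sq :: "real \<Rightarrow> (real \<Rightarrow> real) \<Rightarrow> real" where
  "W22_sq L f = integral {0..2*L} (\<lambda>s. (f s)\<^sup>2 + (deriv f s)\<^sup>2 + (deriv (deriv f) s)\<^sup>2)"

definition second_var :: "((real \<Rightarrow> real \<times> real) \<Rightarrow> real) \<Rightarrow> (real \<Rightarrow> real \<Rightarrow> real \<times> real) \<Rightarrow> real" where
  "second_var G V = deriv (deriv (\<lambda>t. G (\<lambda>s. V s t))) 0"

definition stable_crit :: "real \<Rightarrow> real \<Rightarrow> (real \<Rightarrow> real \<times> real) \<Rightarrow> real \<Rightarrow> bool" where
  "stable_crit x0 L \<gamma> lam \<longleftrightarrow>
     (\<forall>t0 V. admissible_variation x0 L \<gamma> t0 V \<longrightarrow>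
        second_var (\<lambda>c. Fcal L c - lam * area L c) V \<ge> 0)"

definition area_pres_stable :: "real \<Rightarrow> real \<Rightarrow> (real \<Rightarrow> real \<times> real) \<Rightarrow> bool" where
  "area_pres_stable x0 L \<gamma> \<longleftrightarrow>
     (\<forall>t0 V. admissible_variation x0 L \<gamma> t0 V \<longrightarrow> area_preserving L \<gamma> t0 V \<longrightarrow>
        second_var (Fcal L) V \<ge> 0)"

definition gsigma :: "real \<Rightarrow> real \<Rightarrow> real" where
  "gsigma x0 L = pi * sqrt (x0 / (L + x0))"

definition gk :: "real \<Rightarrow> real \<Rightarrow> real" where
  "gk x0 L = L / sin (gsigma x0 L)"

definition gcurve :: "real \<Rightarrow> real \<Rightarrow> real \<Rightarrow> real \<times> real" where
  "gcurve x0 L s =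
    (let \<sigma> = gsigma x0 L; k = gk x0 L; a = arcsin ((s - L) / k) in
     (- k/2 * (\<sigma>/(pi+\<sigma>) * sin ((pi+\<sigma>)/\<sigma> * a) + \<sigma>/(pi-\<sigma>) * sin ((pi-\<sigma>)/\<sigma> * a)),
        k/2 * (\<sigma>/(pi+\<sigma>) * cos ((pi+\<sigma>)/\<sigma> * a) + \<sigma>/(pi-\<sigma>) * cos ((pi-\<sigma>)/\<sigma> * a))
        + pi * x0 / (\<sigma> * tan \<sigma>)))"

definition glambda :: "real \<Rightarrow> real \<Rightarrow> real" where
  "glambda x0 L = 2 * L / (L + x0)"

end

theory Submission
  imports Defs
begin

text \<open>In terms of the tangent angle \<open>\<theta> \<in> [-\<pi>, \<pi>]\<close> the curve has radius of curvature
  \<open>\<rho> = k m cos (m \<theta>)\<close> with \<open>m = \<sigma> / \<pi>\<close>, so \<open>\<rho>'' = - m\<^sup>2 \<rho>\<close> and \<open>\<lambda> = 2 (1 - m\<^sup>2)\<close>: this is the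
  Euler-Lagrange equation of \<open>F - \<lambda> A\<close>. Modulo a divergence, the second derivative of the density
  along a variation with normal velocity \<open>\<phi>\<close> is \<open>2 ((\<phi> + \<phi>'')\<^sup>2 + (1 - m\<^sup>2) (\<phi>'\<^sup>2 - \<phi>\<^sup>2))\<close>.

  The tangent at both end points is horizontal and the competitors stay above the axis. Hence the
  end slopes are stationary to first order in \<open>t\<close>, which makes \<open>\<phi>\<close> clamped, and their second
  \<open>t\<close>-derivatives have a sign, which makes the boundary term nonnegative.

  For clamped \<open>\<phi>\<close> the quadratic form equals
  \<open>m\<^sup>2 \<integral>(\<phi> + \<phi>'')\<^sup>2 + (1 - m\<^sup>2) \<integral>(\<phi>''\<^sup>2 - \<phi>'\<^sup>2)\<close>. The second summand is nonnegative by Wirtinger's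
  inequality. The first controls the \<open>W\<^sup>2\<^sup>,\<^sup>2\<close> norm because \<open>\<phi>\<close> solves an initial value problem
  with right-hand side \<open>\<phi> + \<phi>''\<close>. When the area is preserved, \<open>F\<close> and \<open>F - \<lambda> A\<close> differ by a constant.\<close>

section \<open>Wirtinger inequalities and coercivity\<close>

text \<open>Integration by parts as an inequality: once the integrand dominates an exact derivative
  pointwise, only boundary values remain. Every later "up to a divergence" argument passes through
  this form.\<close>

lemma boundary_le_integral:
  fixes f B B' :: "real \<Rightarrow> real"
  assumes "a \<le> b" and "continuous_on {a..b} f"
    and "\<And>x. x \<in> {a..b} \<Longrightarrow> (B has_real_derivative B' x) (at x within {a..b})"
    and "\<And>x. x \<in> {a..b} \<Longrightarrow> B' x \<le> f x"
  shows "B b - B a \<le> integral {a..b} f"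
proof -
  have "(B' has_integral (B b - B a)) {a..b}"
    by (rule fundamental_theorem_of_calculus)
      (use assms in \<open>auto simp: has_real_derivative_iff_has_vector_derivative[symmetric]\<close>)
  moreover have "(f has_integral integral {a..b} f) {a..b}"
    using assms(2) by (intro integrable_integral integrable_continuous_real)
  ultimately show ?thesis
    by (rule has_integral_le) (use assms in auto)
qed

text \<open>The multiplier \<open>r tan (r (x - pi/2))\<close> with \<open>r < 1\<close> is the logarithmic derivative of a
  positive solution of \<open>v'' + r\<^sup>2 v = 0\<close>; unlike the extremal choice \<open>r = 1\<close> it has no
  singularity at the ends.\<close>

lemma Wirtinger_Dirichlet:
  fixes u u1 :: "real \<Rightarrow> real"
  assumes du: "\<And>x. x \<in> {0..pi} \<Longrightarrow> (u has_real_derivative u1 x) (at x within {0..pi})"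
    and cu: "continuous_on {0..pi} u1" and u0: "u 0 = 0" "u pi = 0"
  shows "integral {0..pi} (\<lambda>x. (u x)\<^sup>2) \<le> integral {0..pi} (\<lambda>x. (u1 x)\<^sup>2)"
\<comment> \<open>It suffices to prove the inequality with each factor z < 1 on the left; then r =
  sqrt z < 1 keeps the tangent multiplier bounded up to both ends.\<close>
proof (rule field_le_mult_one_interval)
  fix z :: real assume z: "0 < z" "z < 1"
  define r where "r = sqrt z"
  have r: "0 < r" "r < 1" "r\<^sup>2 = z" using z by (auto simp: r_def)
  have cu0: "continuous_on {0..pi} u"
    using du by (rule DERIV_continuous_on)
  define t where "t x = tan (r * (x - pi/2))" for x
  define B where "B x = - r * t x * (u x)\<^sup>2" for x
  have "B pi - B 0 \<le> integral {0..pi} (\<lambda>x. (u1 x)\<^sup>2 - z * (u x)\<^sup>2)"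
  proof (rule boundary_le_integral)
    show "continuous_on {0..pi} (\<lambda>x. (u1 x)\<^sup>2 - z * (u x)\<^sup>2)"
      by (intro continuous_intros cu cu0)
  next
    fix x assume x: "x \<in> {0..pi}"
    have "\<bar>r * (x - pi/2)\<bar> < pi/2"
    proof -
      have "\<bar>x - pi/2\<bar> \<le> pi/2" unfolding abs_le_iff using x by (auto simp: field_simps)
      then have "\<bar>r * (x - pi/2)\<bar> \<le> r * (pi/2)"
        using r by (simp add: abs_mult)
      also have "\<dots> < pi/2" using r by simp
      finally show ?thesis .
    qed
    then have "cos (r * (x - pi/2)) > 0"
      by (intro cos_gt_zero_pi) auto
    then have c: "cos (r * (x - pi/2)) \<noteq> 0" by simp
    have ct: "inverse ((cos (r * (x - pi/2)))\<^sup>2) = 1 + (t x)\<^sup>2"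
      using tan_sec[OF c] by (simp add: t_def power_inverse)
    have "(t has_real_derivative r * (1 + (t x)\<^sup>2)) (at x within {0..pi})"
      unfolding t_def[abs_def]
      by (rule derivative_eq_intros refl c)+ (use ct in \<open>simp add: t_def\<close>)
    then show "(B has_real_derivative
        - (r\<^sup>2 * (1 + (t x)\<^sup>2) * (u x)\<^sup>2) - 2 * r * t x * u x * u1 x) (at x within {0..pi})"
      unfolding B_def[abs_def]
      by (auto intro!: derivative_eq_intros du[OF x]) (simp add: power2_eq_square algebra_simps)
    \<comment> \<open>The multiplier solves the Riccati equation t' = r (1 + t^2), so this square is
      exactly the integrand minus the derivative of \<open>B\<close>.\<close>
    have "0 \<le> (u1 x + r * t x * u x)\<^sup>2" by simp
    then show "- (r\<^sup>2 * (1 + (t x)\<^sup>2) * (u x)\<^sup>2) - 2 * r * t x * u x * u1 x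
        \<le> (u1 x)\<^sup>2 - z * (u x)\<^sup>2"
      unfolding r(3)[symmetric] by (simp add: power2_eq_square algebra_simps)
  qed simp
  then have "0 \<le> integral {0..pi} (\<lambda>x. (u1 x)\<^sup>2 - z * (u x)\<^sup>2)"
    by (simp add: B_def u0)
  also have "\<dots> = integral {0..pi} (\<lambda>x. (u1 x)\<^sup>2) - z * integral {0..pi} (\<lambda>x. (u x)\<^sup>2)"
    by (subst integral_diff)
      (auto intro!: integrable_continuous_real continuous_intros cu cu0)
  finally show "z * integral {0..pi} (\<lambda>x. (u x)\<^sup>2) \<le> integral {0..pi} (\<lambda>x. (u1 x)\<^sup>2)"
    by simp
qed

lemma integral_even_part:
  fixes f :: "real \<Rightarrow> real"
  assumes "continuous_on {-a..a} f" "0 \<le> a"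
  shows "integral {-a..a} f = integral {0..a} (\<lambda>x. f x + f (- x))"
proof -
  have c: "continuous_on {0..a} f" "continuous_on {0..a} (\<lambda>x. f (- x))"
    by (auto intro!: continuous_on_subset[OF assms(1)] continuous_on_compose2[OF assms(1)]
        continuous_intros)
  have "integral {-a..a} f = integral {-a..0} f + integral {0..a} f"
    by (rule Henstock_Kurzweil_Integration.integral_combine[symmetric])
      (use assms in \<open>auto intro: integrable_continuous_real\<close>)
  moreover have "integral {-a..0} f = integral {0..a} (\<lambda>x. f (- x))"
    using Henstock_Kurzweil_Integration.integral_reflect_real[of a 0 "\<lambda>x. f (- x)"] by simp
  ultimately show ?thesis
    by (subst integral_add) (auto intro!: integrable_continuous_real c)
qed

text \<open>The even part of a clamped \<open>u\<close> has a derivative vanishing at \<open>0\<close> and \<open>pi\<close>; the odd part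
  itself vanishes there.\<close>

lemma Wirtinger_clamped:
  fixes u u1 u2 :: "real \<Rightarrow> real"
  assumes du: "\<And>x. x \<in> {-pi..pi} \<Longrightarrow> (u has_real_derivative u1 x) (at x within {-pi..pi})"
    and du1: "\<And>x. x \<in> {-pi..pi} \<Longrightarrow> (u1 has_real_derivative u2 x) (at x within {-pi..pi})"
    and cu2: "continuous_on {-pi..pi} u2"
    and bd: "u (-pi) = 0" "u pi = 0" "u1 (-pi) = 0" "u1 pi = 0"
  shows "integral {-pi..pi} (\<lambda>x. (u1 x)\<^sup>2) \<le> integral {-pi..pi} (\<lambda>x. (u2 x)\<^sup>2)"
proof -
  have cu: "continuous_on {-pi..pi} u" using du by (rule DERIV_continuous_on)
  have cu1: "continuous_on {-pi..pi} u1" using du1 by (rule DERIV_continuous_on)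
  have pos: "(f has_real_derivative f') (at x within {0..pi})"
    if "(f has_real_derivative f') (at x within {-pi..pi})" for f f' x
    using that by (rule has_field_derivative_subset) auto
  have neg: "((\<lambda>x. f (- x)) has_real_derivative - f' (- x)) (at x within {0..pi})"
    if "\<And>x. x \<in> {-pi..pi} \<Longrightarrow> (f has_real_derivative f' x) (at x within {-pi..pi})"
      "x \<in> {0..pi}" for f f' x
  proof -
    have "(f has_real_derivative f' (- x)) (at (- x) within uminus ` {0..pi})"
      by (rule has_field_derivative_subset[OF that(1)]) (use that(2) in auto)
    moreover have "(uminus has_real_derivative - 1) (at x within {0..pi})"
      by (auto intro!: derivative_eq_intros)
    ultimately show ?thesis
      using DERIV_image_chain[of f "f' (- x)" uminus x "{0..pi}" "- 1"] by (simp add: o_def)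
  qed
  have c: "continuous_on {0..pi} f" "continuous_on {0..pi} (\<lambda>x. f (- x))"
    if "continuous_on {-pi..pi} f" for f :: "real \<Rightarrow> real"
    by (auto intro!: continuous_on_subset[OF that] continuous_on_compose2[OF that]
        continuous_intros)
  note C = c[OF cu] c[OF cu1] c[OF cu2]
  \<comment> \<open>\<open>p1\<close> is the derivative of twice the even part of \<open>u\<close>,
    and \<open>q\<close> is twice the odd part. Leaving out the factors 1/2 produces the factor 2 in
    the two integral identities that close the proof.\<close>
  define p1 where "p1 x = u1 x - u1 (- x)" for x
  define p2 where "p2 x = u2 x + u2 (- x)" for x
  define q where "q x = u x - u (- x)" for x
  define q1 where "q1 x = u1 x + u1 (- x)" for x
  define q2 where "q2 x = u2 x - u2 (- x)" for x
  note defs = p1_def p2_def q_def q1_def q2_def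
  have dp1: "(p1 has_real_derivative p2 x) (at x within {0..pi})" if "x \<in> {0..pi}" for x
    unfolding defs[abs_def]
    by (rule derivative_eq_intros pos[OF du1] neg[OF du1] | use that in simp)+
  have dq: "(q has_real_derivative q1 x) (at x within {0..pi})" if "x \<in> {0..pi}" for x
    unfolding defs[abs_def]
    by (rule derivative_eq_intros pos[OF du] neg[OF du] | use that in simp)+
  have dq1: "(q1 has_real_derivative q2 x) (at x within {0..pi})" if "x \<in> {0..pi}" for x
    unfolding defs[abs_def]
    by (rule derivative_eq_intros pos[OF du1] neg[OF du1] | use that in simp)+
  have cp: "continuous_on {0..pi} p1" "continuous_on {0..pi} p2"
    "continuous_on {0..pi} q" "continuous_on {0..pi} q1" "continuous_on {0..pi} q2"
    unfolding defs[abs_def] by (intro continuous_intros C)+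
  have P: "integral {0..pi} (\<lambda>x. (p1 x)\<^sup>2) \<le> integral {0..pi} (\<lambda>x. (p2 x)\<^sup>2)"
    by (rule Wirtinger_Dirichlet[OF dp1 cp(2)]) (use cp bd in \<open>auto simp: p1_def\<close>)
  have Q0: "integral {0..pi} (\<lambda>x. (q x)\<^sup>2) \<le> integral {0..pi} (\<lambda>x. (q1 x)\<^sup>2)"
    by (rule Wirtinger_Dirichlet[OF dq cp(4)]) (use cp bd in \<open>auto simp: q_def\<close>)
  \<comment> \<open>\<open>q1\<close> need not vanish at 0, so the Dirichlet inequality cannot be
    repeated for it. Expanding (q + q'')^2 >= 0 and integrating q q'' by parts gives 2 int q'^2 <=
    int q^2 + int q''^2, and \<open>Q0\<close> absorbs int q^2.\<close>
  have "- 2 * q pi * q1 pi - (- 2 * q 0 * q1 0)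
      \<le> integral {0..pi} (\<lambda>x. (q x)\<^sup>2 + (q2 x)\<^sup>2 - 2 * (q1 x)\<^sup>2)"
  proof (rule boundary_le_integral)
    fix x assume x: "x \<in> {0..pi}"
    show "((\<lambda>x. - 2 * q x * q1 x) has_real_derivative - 2 * (q1 x)\<^sup>2 - 2 * q x * q2 x)
        (at x within {0..pi})"
      by (auto intro!: derivative_eq_intros dq[OF x] dq1[OF x] simp: power2_eq_square)
    have "0 \<le> (q x + q2 x)\<^sup>2" by simp
    then show "- 2 * (q1 x)\<^sup>2 - 2 * q x * q2 x \<le> (q x)\<^sup>2 + (q2 x)\<^sup>2 - 2 * (q1 x)\<^sup>2"
      by (simp add: power2_eq_square algebra_simps)
  qed (auto intro!: continuous_intros cp)
  then have "0 \<le> integral {0..pi} (\<lambda>x. (q x)\<^sup>2 + (q2 x)\<^sup>2 - 2 * (q1 x)\<^sup>2)"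
    using bd by (simp add: defs)
  also have "\<dots> = integral {0..pi} (\<lambda>x. (q x)\<^sup>2) + integral {0..pi} (\<lambda>x. (q2 x)\<^sup>2)
      - 2 * integral {0..pi} (\<lambda>x. (q1 x)\<^sup>2)"
    by (subst integral_diff integral_add |
        intro integrable_continuous_real continuous_intros cp | simp)+
  finally have Q: "integral {0..pi} (\<lambda>x. (q1 x)\<^sup>2) \<le> integral {0..pi} (\<lambda>x. (q2 x)\<^sup>2)"
    using Q0 by linarith
  have "2 * integral {-pi..pi} (\<lambda>x. (u1 x)\<^sup>2)
      = integral {0..pi} (\<lambda>x. (p1 x)\<^sup>2) + integral {0..pi} (\<lambda>x. (q1 x)\<^sup>2)"
    by (subst integral_add[symmetric], (intro integrable_continuous_real continuous_intros cp)+,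
        subst integral_even_part, (intro continuous_intros cu1)+, simp,
        subst integral_mult_right[symmetric])
      (auto simp: defs power2_eq_square algebra_simps intro!: integral_cong)
  moreover have "2 * integral {-pi..pi} (\<lambda>x. (u2 x)\<^sup>2)
      = integral {0..pi} (\<lambda>x. (p2 x)\<^sup>2) + integral {0..pi} (\<lambda>x. (q2 x)\<^sup>2)"
    by (subst integral_add[symmetric], (intro integrable_continuous_real continuous_intros cp)+,
        subst integral_even_part, (intro continuous_intros cu2)+, simp,
        subst integral_mult_right[symmetric])
      (auto simp: defs power2_eq_square algebra_simps intro!: integral_cong)
  ultimately show ?thesis using P Q by linarith
qed

text \<open>A Gronwall argument for the oscillator u'' + u = f started at rest. The energy u^2 +
  u'^2 has derivative 2 u' f <= u'^2 + f^2, and the weight exp (a - x) absorbs the term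
  u'^2.\<close>

lemma oscillator_energy_bound:
  fixes u u1 u2 :: "real \<Rightarrow> real"
  assumes ab: "a \<le> b"
    and du: "\<And>x. x \<in> {a..b} \<Longrightarrow> (u has_real_derivative u1 x) (at x within {a..b})"
    and du1: "\<And>x. x \<in> {a..b} \<Longrightarrow> (u1 has_real_derivative u2 x) (at x within {a..b})"
    and cu2: "continuous_on {a..b} u2"
    and bd: "u a = 0" "u1 a = 0" and x: "x \<in> {a..b}"
  shows "(u x)\<^sup>2 + (u1 x)\<^sup>2 \<le> exp (b - a) * integral {a..b} (\<lambda>x. (u x + u2 x)\<^sup>2)"
proof -
  have cu: "continuous_on {a..b} u" using du by (rule DERIV_continuous_on)
  have cu1: "continuous_on {a..b} u1" using du1 by (rule DERIV_continuous_on)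
  define g where "g x = (u x + u2 x)\<^sup>2" for x
  have cg: "continuous_on {a..b} g"
    unfolding g_def[abs_def] by (intro continuous_intros cu cu2)
  define h where "h x = exp (a - x) * ((u x)\<^sup>2 + (u1 x)\<^sup>2)" for x
  have "h x - h a \<le> integral {a..x} g"
  proof (rule boundary_le_integral)
    fix y assume y: "y \<in> {a..x}"
    then have yab: "y \<in> {a..b}" using x by auto
    have sub: "{a..x} \<subseteq> {a..b}" using x by auto
    show "(h has_real_derivative exp (a - y) *
        (2 * u y * u1 y + 2 * u1 y * u2 y - ((u y)\<^sup>2 + (u1 y)\<^sup>2))) (at y within {a..x})"
      unfolding h_def[abs_def]
      by (auto intro!: derivative_eq_intros has_field_derivative_subset[OF du[OF yab] sub]
          has_field_derivative_subset[OF du1[OF yab] sub] simp: algebra_simps)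
    have "2 * u1 y * (u y + u2 y) \<le> (u1 y)\<^sup>2 + g y"
      unfolding g_def using sum_squares_bound[of "u1 y" "u y + u2 y"] by simp
    then have "2 * u y * u1 y + 2 * u1 y * u2 y \<le> (u1 y)\<^sup>2 + g y"
      by (simp add: algebra_simps)
    then have *: "2 * u y * u1 y + 2 * u1 y * u2 y - ((u y)\<^sup>2 + (u1 y)\<^sup>2) \<le> g y"
      using zero_le_power2[of "u y"] by linarith
    have "exp (a - y) * (2 * u y * u1 y + 2 * u1 y * u2 y - ((u y)\<^sup>2 + (u1 y)\<^sup>2))
        \<le> exp (a - y) * g y" using * by (intro mult_left_mono) auto
    also have "\<dots> \<le> 1 * g y" using y by (intro mult_right_mono) (auto simp: g_def)
    finally show "exp (a - y) * (2 * u y * u1 y + 2 * u1 y * u2 y - ((u y)\<^sup>2 + (u1 y)\<^sup>2)) \<le> g y"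
      by simp
  qed (use x continuous_on_subset[OF cg] in auto)
  also have "integral {a..x} g \<le> integral {a..b} g"
    by (rule integral_subset_le)
      (use x in \<open>auto simp: g_def[abs_def] intro!: integrable_continuous_real
        continuous_on_subset[OF cg[unfolded g_def[abs_def]]]\<close>)
  finally have h: "h x \<le> integral {a..b} g" by (simp add: h_def bd)
  have g0: "0 \<le> integral {a..b} g"
    by (rule integral_nonneg) (auto intro!: integrable_continuous_real cg simp: g_def)
  have "(u x)\<^sup>2 + (u1 x)\<^sup>2 = exp (x - a) * h x"
    by (simp add: h_def mult.assoc[symmetric] exp_add[symmetric])
  also have "\<dots> \<le> exp (x - a) * integral {a..b} g" using h by simp
  also have "\<dots> \<le> exp (b - a) * integral {a..b} g" using x g0 by (intro mult_right_mono) auto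
  finally show ?thesis by (simp add: g_def[abs_def])
qed

text \<open>Writing u'' = (u + u'') - u gives u''^2 <= 2 u^2 + 2 (u + u'')^2. The integrand is thus
  at most three times the uniform energy bound plus 2 (u + u'')^2, and integrating the constant part
  gives the factor b - a.\<close>

lemma oscillator_coercive:
  fixes u u1 u2 :: "real \<Rightarrow> real"
  assumes ab: "a \<le> b"
    and du: "\<And>x. x \<in> {a..b} \<Longrightarrow> (u has_real_derivative u1 x) (at x within {a..b})"
    and du1: "\<And>x. x \<in> {a..b} \<Longrightarrow> (u1 has_real_derivative u2 x) (at x within {a..b})"
    and cu2: "continuous_on {a..b} u2"
    and bd: "u a = 0" "u1 a = 0"
  shows "integral {a..b} (\<lambda>x. (u x)\<^sup>2 + (u1 x)\<^sup>2 + (u2 x)\<^sup>2)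
      \<le> (2 + 3 * (b - a) * exp (b - a)) * integral {a..b} (\<lambda>x. (u x + u2 x)\<^sup>2)"
    (is "_ \<le> _ * ?J")
proof -
  have cu: "continuous_on {a..b} u" using du by (rule DERIV_continuous_on)
  have cu1: "continuous_on {a..b} u1" using du1 by (rule DERIV_continuous_on)
  have "integral {a..b} (\<lambda>x. (u x)\<^sup>2 + (u1 x)\<^sup>2 + (u2 x)\<^sup>2)
      \<le> integral {a..b} (\<lambda>x. 3 * (exp (b - a) * ?J) + 2 * (u x + u2 x)\<^sup>2)"
  proof (rule integral_le)
    fix x assume "x \<in> {a..b}"
    then have e: "(u x)\<^sup>2 + (u1 x)\<^sup>2 \<le> exp (b - a) * ?J"
      by (intro oscillator_energy_bound assms)
    have "0 \<le> (u x + (u x + u2 x))\<^sup>2" by simp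
    then have "(u2 x)\<^sup>2 \<le> 2 * (u x)\<^sup>2 + 2 * (u x + u2 x)\<^sup>2"
      by (simp add: power2_eq_square algebra_simps)
    then show "(u x)\<^sup>2 + (u1 x)\<^sup>2 + (u2 x)\<^sup>2 \<le> 3 * (exp (b - a) * ?J) + 2 * (u x + u2 x)\<^sup>2"
      using e zero_le_power2[of "u1 x"] by linarith
  qed (auto intro!: integrable_continuous_real continuous_intros cu cu1 cu2)
  also have "\<dots> = (2 + 3 * (b - a) * exp (b - a)) * ?J"
    by (subst integral_add)
      (use ab in \<open>auto intro!: integrable_continuous_real continuous_intros cu cu2
        simp: algebra_simps\<close>)
  finally show ?thesis .
qed

text \<open>With \<open>m = 1\<close> the form is degenerate; it is \<open>m\<^sup>2 (u'' + u)\<^sup>2 + (1 - m\<^sup>2) (u''\<^sup>2 - u'\<^sup>2)\<close> up to a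
  divergence.\<close>

lemma stability_form_coercive:
  fixes u u1 u2 :: "real \<Rightarrow> real"
  assumes du: "\<And>x. x \<in> {-pi..pi} \<Longrightarrow> (u has_real_derivative u1 x) (at x within {-pi..pi})"
    and du1: "\<And>x. x \<in> {-pi..pi} \<Longrightarrow> (u1 has_real_derivative u2 x) (at x within {-pi..pi})"
    and cu2: "continuous_on {-pi..pi} u2"
    and bd: "u (-pi) = 0" "u pi = 0" "u1 (-pi) = 0" "u1 pi = 0"
    and m: "0 < m" "m \<le> 1"
  shows "m\<^sup>2 / (2 + 6 * pi * exp (2 * pi)) *
        integral {-pi..pi} (\<lambda>x. (u x)\<^sup>2 + (u1 x)\<^sup>2 + (u2 x)\<^sup>2)
      \<le> integral {-pi..pi} (\<lambda>x. (u x + u2 x)\<^sup>2 + (1 - m\<^sup>2) * ((u1 x)\<^sup>2 - (u x)\<^sup>2))"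
proof -
  have cu: "continuous_on {-pi..pi} u" using du by (rule DERIV_continuous_on)
  have cu1: "continuous_on {-pi..pi} u1" using du1 by (rule DERIV_continuous_on)
  note C = cu cu1 cu2
  have mm: "m\<^sup>2 \<le> 1" using m by (simp add: power_le_one)
  define K where "K = 2 + 6 * pi * exp (2 * pi)"
  have K: "K > 0" unfolding K_def by (intro add_pos_pos) auto
  define J where "J = integral {-pi..pi} (\<lambda>x. (u x + u2 x)\<^sup>2)"
  have 1: "integral {-pi..pi} (\<lambda>x. (u x)\<^sup>2 + (u1 x)\<^sup>2 + (u2 x)\<^sup>2) \<le> K * J"
    using oscillator_coercive[of "-pi" pi u u1 u2] du du1 cu2 bd
    by (simp add: K_def J_def)
  \<comment> \<open>The two forms differ exactly by the derivative of
    \<open>2 * (1 - m\<^sup>2) * u * u1\<close>, which integrates to zero for clamped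
    \<open>u\<close>.\<close>
  have "2 * (1 - m\<^sup>2) * u pi * u1 pi - 2 * (1 - m\<^sup>2) * u (-pi) * u1 (-pi)
    \<le> integral {-pi..pi} (\<lambda>x. (u x + u2 x)\<^sup>2 + (1 - m\<^sup>2) * ((u1 x)\<^sup>2 - (u x)\<^sup>2)
          - (m\<^sup>2 * (u x + u2 x)\<^sup>2 + (1 - m\<^sup>2) * ((u2 x)\<^sup>2 - (u1 x)\<^sup>2)))"
  proof (rule boundary_le_integral)
    fix x assume x: "x \<in> {-pi..pi}"
    show "((\<lambda>x. 2 * (1 - m\<^sup>2) * u x * u1 x) has_real_derivative
        2 * (1 - m\<^sup>2) * ((u1 x)\<^sup>2 + u x * u2 x)) (at x within {-pi..pi})"
      by (auto intro!: derivative_eq_intros du[OF x] du1[OF x]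
          simp: power2_eq_square algebra_simps)
  qed (auto intro!: continuous_intros C simp: power2_eq_square algebra_simps)
  then have "0 \<le> integral {-pi..pi} (\<lambda>x. (u x + u2 x)\<^sup>2 + (1 - m\<^sup>2) * ((u1 x)\<^sup>2 - (u x)\<^sup>2))
          - integral {-pi..pi} (\<lambda>x. m\<^sup>2 * (u x + u2 x)\<^sup>2 + (1 - m\<^sup>2) * ((u2 x)\<^sup>2 - (u1 x)\<^sup>2))"
    by (subst integral_diff[symmetric])
      (auto intro!: integrable_continuous_real continuous_intros C simp: bd)
  moreover have "integral {-pi..pi}
        (\<lambda>x. m\<^sup>2 * (u x + u2 x)\<^sup>2 + (1 - m\<^sup>2) * ((u2 x)\<^sup>2 - (u1 x)\<^sup>2))
      = m\<^sup>2 * J + (1 - m\<^sup>2) *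
        (integral {-pi..pi} (\<lambda>x. (u2 x)\<^sup>2) - integral {-pi..pi} (\<lambda>x. (u1 x)\<^sup>2))"
    unfolding J_def
    by (subst integral_add integral_diff[symmetric] integral_mult_right |
        intro integrable_continuous_real continuous_intros C | simp)+
  moreover have "0 \<le> (1 - m\<^sup>2) *
        (integral {-pi..pi} (\<lambda>x. (u2 x)\<^sup>2) - integral {-pi..pi} (\<lambda>x. (u1 x)\<^sup>2))"
    using Wirtinger_clamped[of u u1 u2] assms mm by (intro mult_nonneg_nonneg) auto
  ultimately have 2: "m\<^sup>2 * J \<le>
      integral {-pi..pi} (\<lambda>x. (u x + u2 x)\<^sup>2 + (1 - m\<^sup>2) * ((u1 x)\<^sup>2 - (u x)\<^sup>2))"
    by linarith
  have "m\<^sup>2 / K * integral {-pi..pi} (\<lambda>x. (u x)\<^sup>2 + (u1 x)\<^sup>2 + (u2 x)\<^sup>2) \<le> m\<^sup>2 / K * (K * J)"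
    using 1 K by (intro mult_left_mono) auto
  then show ?thesis using 2 K by (simp add: K_def[symmetric])
qed

section \<open>Partial derivatives of smooth maps\<close>

lemma open_contains_rectangle:
  fixes U :: "(real \<times> real) set"
  assumes "open U" "(a, b) \<in> U"
  obtains d where "d > 0" "{a-d..a+d} \<times> {b-d..b+d} \<subseteq> U"
proof -
  obtain A B where AB: "open A" "open B" "(a, b) \<in> A \<times> B" "A \<times> B \<subseteq> U"
    using assms by (rule open_prod_elim)
  obtain d where d: "d > 0" "cball a d \<subseteq> A"
    using AB open_contains_cball by blast
  obtain e where e: "e > 0" "cball b e \<subseteq> B"
    using AB open_contains_cball by blast
  have "{a - min d e..a + min d e} \<subseteq> cball a d" "{b - min d e..b + min d e} \<subseteq> cball b e"
    by (auto simp: cball_def dist_real_def)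
  with d e AB(4) have "{a - min d e..a + min d e} \<times> {b - min d e..b + min d e} \<subseteq> U"
    by blast
  with d e show ?thesis by (intro that[of "min d e"]) auto
qed

text \<open>Differentiate \<open>\<integral> D\<^sub>t D\<^sub>s f ds = D\<^sub>t \<integral> D\<^sub>s f ds\<close> in \<open>s\<close>.\<close>

lemma mixed_partials_eq:
  fixes f :: "real \<Rightarrow> real \<Rightarrow> 'a::euclidean_space"
  assumes U: "open U" "(a, b) \<in> U"
    and fs: "\<And>s t. (s, t) \<in> U \<Longrightarrow> ((\<lambda>s. f s t) has_vector_derivative fs s t) (at s)"
    and ft: "\<And>s t. (s, t) \<in> U \<Longrightarrow> (f s has_vector_derivative ft s t) (at t)"
    and dfst: "\<And>s t. (s, t) \<in> U \<Longrightarrow> (fs s has_vector_derivative f_st s t) (at t)"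
    and f_ts: "\<And>s t. (s, t) \<in> U \<Longrightarrow> ((\<lambda>s. ft s t) has_vector_derivative f_ts s t) (at s)"
    and cfs: "continuous_on U (\<lambda>(s, t). fs s t)"
    and cfst: "continuous_on U (\<lambda>(s, t). f_st s t)"
  shows "f_st a b = f_ts a b"
proof -
  obtain d where d: "d > 0" and R: "{a-d..a+d} \<times> {b-d..b+d} \<subseteq> U"
    using open_contains_rectangle[OF U] by blast
  have inR: "(s, t) \<in> U" if "s \<in> {a-d..a+d}" "t \<in> {b-d..b+d}" for s t
    using R that by blast
  have cs: "continuous_on {a-d..a+d} (\<lambda>s. fs s t)" "continuous_on {a-d..a+d} (\<lambda>s. f_st s t)"
    if "t \<in> {b-d..b+d}" for t
    by (rule continuous_on_compose2[OF cfs, where f="\<lambda>s. (s, t)", simplified]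
        continuous_on_compose2[OF cfst, where f="\<lambda>s. (s, t)", simplified],
        (use inR that in \<open>auto intro!: continuous_intros\<close>))+
  have eq: "ft x b - ft (a-d) b = integral {a-d..x} (\<lambda>s. f_st s b)" if x: "x \<in> {a-d..a+d}" for x
  proof -
    have xs: "{a-d..x} \<subseteq> {a-d..a+d}" using x by auto
    have "((\<lambda>t. integral (cbox (a-d) x) (\<lambda>s. fs s t)) has_vector_derivative
        integral (cbox (a-d) x) (\<lambda>s. f_st s b)) (at b within {b-d..b+d})"
    proof (rule leibniz_rule_vector_derivative)
      show "continuous_on ({b-d..b+d} \<times> cbox (a-d) x) (\<lambda>(t, s). f_st s t)"
      proof -
        have "continuous_on ({b-d..b+d} \<times> cbox (a-d) x)
            (\<lambda>p. (\<lambda>(s, t). f_st s t) (snd p, fst p))"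
          by (rule continuous_on_compose2[OF cfst])
            (use xs inR in \<open>auto intro!: continuous_intros\<close>)
        then show ?thesis by (simp add: split_beta)
      qed
    next
      fix t assume t: "t \<in> {b-d..b+d}"
      show "(\<lambda>s. fs s t) integrable_on cbox (a-d) x"
        unfolding cbox_interval
        by (rule integrable_continuous_real[OF continuous_on_subset[OF cs(1)[OF t] xs]])
      fix s assume "s \<in> cbox (a-d) x"
      then have "(s, t) \<in> U" using xs t by (intro inR) auto
      then show "(fs s has_vector_derivative f_st s t) (at t within {b-d..b+d})"
        by (rule has_vector_derivative_at_within[OF dfst])
    qed (use d in auto)
    moreover have "((\<lambda>t. f x t - f (a-d) t) has_vector_derivative ft x b - ft (a-d) b)
        (at b within {b-d..b+d})"
      using d x by (intro has_vector_derivative_diff has_vector_derivative_at_within[OF ft] inR) auto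
    moreover have "integral (cbox (a-d) x) (\<lambda>s. fs s t) = f x t - f (a-d) t"
      if "t \<in> {b-d..b+d}" for t
      unfolding cbox_interval
      by (rule integral_unique, rule fundamental_theorem_of_calculus)
        (use x xs inR that in \<open>auto intro!: has_vector_derivative_at_within[OF fs]\<close>)
    ultimately have "((\<lambda>t. f x t - f (a-d) t) has_vector_derivative
        integral (cbox (a-d) x) (\<lambda>s. f_st s b)) (at b within {b-d..b+d})"
      and "((\<lambda>t. f x t - f (a-d) t) has_vector_derivative ft x b - ft (a-d) b)
        (at b within {b-d..b+d})"
      using d by (auto elim!: has_vector_derivative_transform[rotated 2])
    then show ?thesis
      using d vector_derivative_unique_within_closed_interval[of "b-d" "b+d" b "\<lambda>t. f x t - f (a-d) t"
          "ft x b - ft (a-d) b" "integral {a-d..x} (\<lambda>s. f_st s b)"]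
      by simp
  qed
  have "((\<lambda>x. integral {a-d..x} (\<lambda>s. f_st s b)) has_vector_derivative f_st a b)
      (at a within {a-d..a+d})"
    using d cs by (intro integral_has_vector_derivative) auto
  then have "((\<lambda>x. ft x b - ft (a-d) b) has_vector_derivative f_st a b) (at a within {a-d..a+d})"
    by (rule has_vector_derivative_transform[rotated -1]) (use d eq in auto)
  moreover have "((\<lambda>x. ft x b - ft (a-d) b) has_vector_derivative f_ts a b - 0)
      (at a within {a-d..a+d})"
    by (rule has_vector_derivative_diff[OF has_vector_derivative_at_within[OF f_ts[OF U(2)]]
          has_vector_derivative_const])
  ultimately show ?thesis
    using d vector_derivative_unique_within_closed_interval[of "a-d" "a+d" a] by simp
qed

text \<open>Replaces words of directions in \<open>iter_dderiv\<close> by a doubly indexed family: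
  \<open>A i j\<close> is differentiated \<open>i\<close> times in the first and \<open>j\<close>
  times in the second variable. The family belongs to a smooth extension to an open set, so
  two-sided derivatives exist also at boundary points of \<open>S\<close>.\<close>

lemma C_inf_on_partials:
  fixes V :: "real \<times> real \<Rightarrow> 'b::euclidean_space"
  assumes "C_inf_on S V"
  obtains U and A :: "nat \<Rightarrow> nat \<Rightarrow> real \<Rightarrow> real \<Rightarrow> 'b"
  where "open U" "S \<subseteq> U" "\<And>p. p \<in> S \<Longrightarrow> A 0 0 (fst p) (snd p) = V p"
    "\<And>i j s t. (s, t) \<in> U \<Longrightarrow> ((\<lambda>s. A i j s t) has_vector_derivative A (Suc i) j s t) (at s)"
    "\<And>i j s t. (s, t) \<in> U \<Longrightarrow> (A i j s has_vector_derivative A i (Suc j) s t) (at t)"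
    "\<And>i j. continuous_on U (\<lambda>(s, t). A i j s t)"
proof -
  obtain U g where U: "open U" "S \<subseteq> U" "\<And>x. x \<in> S \<Longrightarrow> g x = V x"
    and g: "\<And>vs x. x \<in> U \<Longrightarrow> iter_dderiv vs g differentiable (at x)"
    using assms unfolding C_inf_on_def by blast
  define P where "P vs s t = iter_dderiv vs g (s, t)" for vs s t
  define e :: "real \<times> real" where "e = (1, 0)"
  define f :: "real \<times> real" where "f = (0, 1)"
  have c: "continuous_on U (\<lambda>(s, t). P vs s t)" for vs
    unfolding P_def split_def
    using g by (auto intro!: continuous_at_imp_continuous_on differentiable_imp_continuous_within)
  have D: "((\<lambda>h. iter_dderiv vs g (p + h *\<^sub>R v)) has_vector_derivative
      iter_dderiv (v # vs) g p) (at 0)" if "p \<in> U" for vs p v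
  proof -
    have "(iter_dderiv vs g has_derivative frechet_derivative (iter_dderiv vs g) (at p)) (at p)"
      using g[OF that] by (simp add: frechet_derivative_works)
    then have d: "(iter_dderiv vs g has_derivative frechet_derivative (iter_dderiv vs g) (at p))
        (at (p + 0 *\<^sub>R v))" by simp
    have l: "linear (frechet_derivative (iter_dderiv vs g) (at p))"
      using g[OF that] by (rule linear_frechet_derivative)
    have "((\<lambda>h::real. p + h *\<^sub>R v) has_derivative (\<lambda>h. h *\<^sub>R v)) (at 0)"
      by (auto intro!: derivative_eq_intros)
    from has_derivative_compose[OF this d] show ?thesis
      by (simp add: has_vector_derivative_def linear_cmul[OF l])
  qed
  have shift: "(F has_vector_derivative D) (at x)"
    if "((\<lambda>h. F (x + h)) has_vector_derivative D) (at 0)" for F :: "real \<Rightarrow> 'b" and D x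
  proof -
    have "((\<lambda>y. y - x) has_vector_derivative 1) (at x)"
      by (auto intro!: derivative_eq_intros)
    from vector_diff_chain_at[OF this, of "\<lambda>h. F (x + h)" D] that show ?thesis
      by (simp add: o_def)
  qed
  have Ps: "((\<lambda>s. P vs s t) has_vector_derivative P (e # vs) s t) (at s)" if "(s, t) \<in> U" for vs s t
    by (rule shift) (use D[OF that, of vs e] in \<open>simp add: P_def e_def\<close>)
  have Pt: "(P vs s has_vector_derivative P (f # vs) s t) (at t)" if "(s, t) \<in> U" for vs s t
    by (rule shift) (use D[OF that, of vs f] in \<open>simp add: P_def f_def\<close>)
  have swap: "P (f # e # vs) s t = P (e # f # vs) s t" if "(s, t) \<in> U" for vs s t
    by (rule mixed_partials_eq[OF U(1) that, of "P vs" "P (e # vs)" "P (f # vs)"])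
      (auto intro: Ps Pt c)
  \<comment> \<open>The head of the word is the outermost derivative. With the first-variable
    directions in front, raising \<open>i\<close> is immediate, while raising \<open>j\<close>
    requires commuting one \<open>f\<close> past all the \<open>e\<close>.\<close>
  define A where "A i j = P (replicate i e @ replicate j f)" for i j
  have As: "((\<lambda>s. A i j s t) has_vector_derivative A (Suc i) j s t) (at s)"
    if "(s, t) \<in> U" for i j s t
    using Ps[OF that] by (simp add: A_def)
  \<comment> \<open>Induction on \<open>i\<close>: the induction hypothesis holds on an open slice
    in \<open>s\<close>, so it may be differentiated there, and \<open>swap\<close> exchanges the
    two leading directions.\<close>
  have "P (f # replicate i e @ replicate j f) s t = A i (Suc j) s t" if "(s, t) \<in> U" for i j s t
    using that
  proof (induction i arbitrary: s t)
    case 0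
    then show ?case by (simp add: A_def)
  next
    case (Suc i)
    define vs where "vs = replicate i e @ replicate j f"
    have "((\<lambda>s. P (f # vs) s t) has_vector_derivative P (e # f # vs) s t) (at s)"
      by (rule Ps) fact
    moreover have "((\<lambda>s. P (f # vs) s t) has_vector_derivative A (Suc i) (Suc j) s t) (at s)"
    proof (rule has_vector_derivative_transform_within_open[OF As[OF Suc.prems]])
      show "open {s. (s, t) \<in> U}"
        using open_vimage[OF U(1), of "\<lambda>s. (s, t)"]
        by (simp add: vimage_def continuous_intros)
    qed (use Suc in \<open>auto simp: vs_def\<close>)
    ultimately have "P (e # f # vs) s t = A (Suc i) (Suc j) s t"
      by (rule vector_derivative_unique_at)
    then show ?case using swap[OF Suc.prems, of vs] by (simp add: vs_def)
  qed
  then have At: "(A i j s has_vector_derivative A i (Suc j) s t) (at t)"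
    if "(s, t) \<in> U" for i j s t
    using Pt[OF that, of "replicate i e @ replicate j f"] that by (simp add: A_def)
  show ?thesis
    by (rule that[of U A]) (use U As At c in \<open>auto simp: A_def P_def\<close>)
qed

section \<open>The second variation in the tangent angle\<close>

text \<open>The Leibniz rule applied twice. The first derivative has to be identified on a whole
  neighbourhood of 0 before \<open>deriv\<close> can be applied again.\<close>

lemma second_deriv_integral:
  fixes f f1 f2 :: "real \<Rightarrow> real \<Rightarrow> real"
  assumes d: "d > 0"
    and f: "\<And>t x. t \<in> {-d<..<d} \<Longrightarrow> x \<in> {a..b} \<Longrightarrow>
        ((\<lambda>t. f t x) has_real_derivative f1 t x) (at t)"
    and f1: "\<And>t x. t \<in> {-d<..<d} \<Longrightarrow> x \<in> {a..b} \<Longrightarrow>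
        ((\<lambda>t. f1 t x) has_real_derivative f2 t x) (at t)"
    and c: "continuous_on ({-d<..<d} \<times> {a..b}) (\<lambda>p. f (fst p) (snd p))"
    and c1: "continuous_on ({-d<..<d} \<times> {a..b}) (\<lambda>p. f1 (fst p) (snd p))"
    and c2: "continuous_on ({-d<..<d} \<times> {a..b}) (\<lambda>p. f2 (fst p) (snd p))"
    and E: "\<And>t. t \<in> {-d<..<d} \<Longrightarrow> E t = integral {a..b} (f t)"
  shows "deriv (deriv E) 0 = integral {a..b} (f2 0)"
proof -
  have slice: "g t integrable_on {a..b}"
    if "continuous_on ({-d<..<d} \<times> {a..b}) (\<lambda>p. g (fst p) (snd p))" "t \<in> {-d<..<d}"
    for g :: "real \<Rightarrow> real \<Rightarrow> real" and t
  proof -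
    have "continuous_on {a..b} (\<lambda>x. g (fst (t, x)) (snd (t, x)))"
      by (rule continuous_on_compose2[OF that(1)]) (use that(2) in \<open>auto intro!: continuous_intros\<close>)
    then show ?thesis by (intro integrable_continuous_real) simp
  qed
  have L: "((\<lambda>t. integral {a..b} (g t)) has_real_derivative integral {a..b} (g' t)) (at t)"
    if g: "\<And>t x. t \<in> {-d<..<d} \<Longrightarrow> x \<in> {a..b} \<Longrightarrow>
        ((\<lambda>t. g t x) has_real_derivative g' t x) (at t)"
      and cg: "continuous_on ({-d<..<d} \<times> {a..b}) (\<lambda>p. g (fst p) (snd p))"
      and cg': "continuous_on ({-d<..<d} \<times> {a..b}) (\<lambda>p. g' (fst p) (snd p))"
      and t: "t \<in> {-d<..<d}"
    for g g' :: "real \<Rightarrow> real \<Rightarrow> real" and t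
  proof -
    have "((\<lambda>t. integral (cbox a b) (g t)) has_real_derivative integral (cbox a b) (g' t))
        (at t within {-d<..<d})"
    proof (rule leibniz_rule_field_derivative)
      show "((\<lambda>t. g t x) has_real_derivative g' t x) (at t within {-d<..<d})"
        if "t \<in> {-d<..<d}" "x \<in> cbox a b" for t x
        by (rule has_field_derivative_at_within[OF g]) (use that in auto)
      show "g t integrable_on cbox a b" if "t \<in> {-d<..<d}" for t
        using slice[OF cg that] by simp
      show "continuous_on ({-d<..<d} \<times> cbox a b) (\<lambda>(t, x). g' t x)"
        using cg' by (simp add: case_prod_unfold)
    qed (use t in auto)
    then show ?thesis using at_within_open[OF t] by simp
  qed
  have ev: "eventually (\<lambda>t. t \<in> {-d<..<d}) (nhds 0)"
    using d by (intro eventually_nhds_in_open) auto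
  have E1: "deriv E t = integral {a..b} (f1 t)" if t: "t \<in> {-d<..<d}" for t
  proof -
    have "eventually (\<lambda>s. s \<in> {-d<..<d}) (nhds t)"
      using t by (intro eventually_nhds_in_open) auto
    then have "eventually (\<lambda>s. E s = integral {a..b} (f s)) (nhds t)"
      by eventually_elim (rule E)
    then have "deriv E t = deriv (\<lambda>s. integral {a..b} (f s)) t"
      by (intro deriv_cong_ev refl)
    also have "\<dots> = integral {a..b} (f1 t)"
      by (rule DERIV_imp_deriv, rule L[OF f c c1 t])
    finally show ?thesis .
  qed
  have "deriv (deriv E) 0 = deriv (\<lambda>t. integral {a..b} (f1 t)) 0"
    by (rule deriv_cong_ev) (use ev E1 in \<open>auto elim: eventually_mono\<close>)
  also have "\<dots> = integral {a..b} (f2 0)"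
    by (rule DERIV_imp_deriv, rule L[OF f1 c1 c2]) (use d in auto)
  finally show ?thesis .
qed

text \<open>First and second order conditions at a minimum. If \<open>h2\<close> were negative,
  \<open>h1\<close> would be negative just to the right of 0, and the mean value theorem would give
  a value below \<open>h 0\<close>. It is applied in the time variable to the slopes of the
  competitors at the end points.\<close>

lemma boundary_second_derivative_nonneg:
  fixes h h1 :: "real \<Rightarrow> real"
  assumes d: "d > 0"
    and h: "\<And>t. t \<in> {-d<..<d} \<Longrightarrow> (h has_real_derivative h1 t) (at t)"
    and h1: "(h1 has_real_derivative h2) (at 0)"
    and nonneg: "\<And>t. t \<in> {-d<..<d} \<Longrightarrow> h 0 \<le> h t"
  shows "h1 0 = 0" and "0 \<le> h2"
proof -
  show z: "h1 0 = 0"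
    by (rule DERIV_local_min[OF h d]) (use d nonneg in \<open>auto simp: abs_less_iff\<close>)
  show "0 \<le> h2"
  proof (rule ccontr)
    assume "\<not> 0 \<le> h2"
    then obtain e where e: "e > 0" "\<And>t. 0 < t \<Longrightarrow> t < e \<Longrightarrow> h1 t < 0"
      using DERIV_neg_dec_right[OF h1] z by auto
    define r where "r = min d e / 2"
    have r: "0 < r" "r < d" "r < e" using d e by (auto simp: r_def)
    have "\<exists>z. 0 < z \<and> z < r \<and> h r - h 0 = (r - 0) * h1 z"
      by (rule MVT2) (use r h in auto)
    then obtain z where z: "0 < z" "z < r" "h r - h 0 = r * h1 z" by auto
    then have "r * h1 z < 0" using e(2)[of z] r by (intro mult_pos_neg) auto
    then have "h r < h 0" using z(3) by linarith
    then show False using nonneg[of r] r by auto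
  qed
qed

text \<open>Here \<open>G = |\<gamma>'|\<^sup>2\<close>, \<open>D = det (\<gamma>', \<gamma>'')\<close> and \<open>M = det (\<gamma>, \<gamma>')\<close>, so that
  \<open>G\<^sup>2 / D\<close> is the density of the total inverse curvature and \<open>M / 2\<close> that of the area.\<close>

lemma quotient_second_derivative:
  fixes G G1 G2 D D1 D2 M M1 M2 :: "real \<Rightarrow> real"
  assumes "(G has_real_derivative G1 t) (at t)" "(G1 has_real_derivative G2 t) (at t)"
    "(D has_real_derivative D1 t) (at t)" "(D1 has_real_derivative D2 t) (at t)"
    "(M has_real_derivative M1 t) (at t)" "(M1 has_real_derivative M2 t) (at t)"
    and D: "D t \<noteq> 0"
  shows "((\<lambda>t. (G t)\<^sup>2 / D t - c * M t) has_real_derivative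
      2 * G t * G1 t / D t - (G t)\<^sup>2 * D1 t / (D t)\<^sup>2 - c * M1 t) (at t)"
    and "((\<lambda>t. 2 * G t * G1 t / D t - (G t)\<^sup>2 * D1 t / (D t)\<^sup>2 - c * M1 t) has_real_derivative
      (2 * (G1 t)\<^sup>2 + 2 * G t * G2 t) / D t - 4 * G t * G1 t * D1 t / (D t)\<^sup>2
      - (G t)\<^sup>2 * D2 t / (D t)\<^sup>2 + 2 * (G t)\<^sup>2 * (D1 t)\<^sup>2 / (D t) ^ 3 - c * M2 t) (at t)"
proof -
  define J where "J t = inverse (D t)" for t
  have "(J has_real_derivative - D1 t * (J t)\<^sup>2) (at t)"
    unfolding J_def[abs_def]
    by (rule DERIV_cong[OF DERIV_inverse'[OF assms(3) D]]) (simp add: power2_eq_square)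
  note d = assms(1-6) this
  have "((\<lambda>t. (G t)\<^sup>2 * J t - c * M t) has_real_derivative
      2 * G t * G1 t * J t - (G t)\<^sup>2 * D1 t * (J t)\<^sup>2 - c * M1 t) (at t)"
    by (rule derivative_eq_intros d refl)+ (simp add: algebra_simps power2_eq_square)
  then show "((\<lambda>t. (G t)\<^sup>2 / D t - c * M t) has_real_derivative
      2 * G t * G1 t / D t - (G t)\<^sup>2 * D1 t / (D t)\<^sup>2 - c * M1 t) (at t)"
    by (simp add: J_def divide_inverse power_inverse)
  have "((\<lambda>t. 2 * G t * G1 t * J t - (G t)\<^sup>2 * D1 t * (J t)\<^sup>2 - c * M1 t) has_real_derivative
      (2 * (G1 t)\<^sup>2 + 2 * G t * G2 t) * J t - 4 * G t * G1 t * D1 t * (J t)\<^sup>2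
      - (G t)\<^sup>2 * D2 t * (J t)\<^sup>2 + 2 * (G t)\<^sup>2 * (D1 t)\<^sup>2 * (J t) ^ 3 - c * M2 t) (at t)"
    by (rule derivative_eq_intros d refl)+
      (simp add: algebra_simps power2_eq_square power3_eq_cube)
  then show "((\<lambda>t. 2 * G t * G1 t / D t - (G t)\<^sup>2 * D1 t / (D t)\<^sup>2 - c * M1 t) has_real_derivative
      (2 * (G1 t)\<^sup>2 + 2 * G t * G2 t) / D t - 4 * G t * G1 t * D1 t / (D t)\<^sup>2
      - (G t)\<^sup>2 * D2 t / (D t)\<^sup>2 + 2 * (G t)\<^sup>2 * (D1 t)\<^sup>2 / (D t) ^ 3 - c * M2 t) (at t)"
    by (simp add: J_def divide_inverse power_inverse)
qed

text \<open>The unit tangent (-cos, -sin) and the normal (-sin, cos) form an orthonormal frame of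
  determinant -1. Inner products are therefore preserved and determinants change sign, which
  explains the order of the factors in the second identity.\<close>

lemma frame_dot_det:
  fixes C S :: real
  assumes "C\<^sup>2 + S\<^sup>2 = 1"
  shows "(- C * x - S * y) * (- C * x' - S * y') + (- S * x + C * y) * (- S * x' + C * y')
      = x * x' + y * y'"
    and "(- S * x + C * y) * (- C * x' - S * y') - (- C * x - S * y) * (- S * x' + C * y')
      = x * y' - y * x'"
proof -
  have "(- C * x - S * y) * (- C * x' - S * y') + (- S * x + C * y) * (- S * x' + C * y')
      = (x * x' + y * y') * (C\<^sup>2 + S\<^sup>2)"
    by (simp add: algebra_simps power2_eq_square)
  then show "(- C * x - S * y) * (- C * x' - S * y') + (- S * x + C * y) * (- S * x' + C * y')
      = x * x' + y * y'" using assms by simp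
  have "(- S * x + C * y) * (- C * x' - S * y') - (- C * x - S * y) * (- S * x' + C * y')
      = (x * y' - y * x') * (C\<^sup>2 + S\<^sup>2)"
    by (simp add: algebra_simps power2_eq_square)
  then show "(- S * x + C * y) * (- C * x' - S * y') - (- C * x - S * y) * (- S * x' + C * y')
      = x * y' - y * x'" using assms by simp
qed

text \<open>Pointwise second variation of the density in the moving frame. Here \<open>(\<tau>, \<phi>)\<close>, \<open>(a, b)\<close>,
  \<open>(A, B)\<close> are the tangential and normal components of the velocity and its first two derivatives
  in the tangent angle; \<open>(\<eta>, \<zeta>)\<close> and \<open>(p, q)\<close> are those of the acceleration and its derivative,
  \<open>Q\<close> is the normal component of the second derivative of the acceleration, \<open>R\<close> is the derivative
  of the radius of curvature \<open>\<rho>\<close>, and \<open>g\<close> is the determinant of the position and the derivative of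
  the acceleration. The last five lines are the derivative of the boundary term.\<close>

lemma second_variation_density:
  fixes \<rho> R m \<tau> \<phi> a b A B \<eta> \<zeta> p q Q g :: real
  assumes "\<rho> \<noteq> 0"
  defines "G1 \<equiv> 2 * (\<rho> * a)" and "G2 \<equiv> 2 * (a\<^sup>2 + b\<^sup>2) + 2 * (\<rho> * p)"
    and "D1 \<equiv> b * R + a * \<rho> - \<rho> * B"
    and "D2 \<equiv> q * R + p * \<rho> + 2 * (b * A - a * B) - \<rho> * Q"
    and "M2 \<equiv> \<zeta> * \<rho> + 2 * (\<phi> * a - \<tau> * b) + g"
  shows "(2 * G1\<^sup>2 + 2 * \<rho>\<^sup>2 * G2) / \<rho>\<^sup>2 - 4 * \<rho>\<^sup>2 * G1 * D1 / (\<rho>\<^sup>2)\<^sup>2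
      - (\<rho>\<^sup>2)\<^sup>2 * D2 / (\<rho>\<^sup>2)\<^sup>2 + 2 * (\<rho>\<^sup>2)\<^sup>2 * D1\<^sup>2 / (\<rho>\<^sup>2) ^ 3 - (1 - m\<^sup>2) * M2
    = 2 * ((B + 2 * a)\<^sup>2 + (1 - m\<^sup>2) * ((b + \<tau>)\<^sup>2 - \<phi>\<^sup>2))
      + (- 2 * ((A - b) * b + a * (B + a)
          + (2 * b * (B + a) * (R / \<rho>) + b\<^sup>2 * (- m\<^sup>2 - (R / \<rho>)\<^sup>2))
          + (1 - m\<^sup>2) * ((b + \<tau>) * \<tau> + \<phi> * (a - \<phi>)))
        + (R * q + \<rho> * (Q + p)) - 2 * (- m\<^sup>2 * \<rho> * \<zeta> + R * (q + \<eta>))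
        + 2 * (R * \<eta> + \<rho> * (p - \<zeta>)) - (1 - m\<^sup>2) * (g - \<rho> * \<zeta>))"
proof -
  define r where "r = R / \<rho>"
  have R: "R = r * \<rho>" using assms(1) by (simp add: r_def)
  \<comment> \<open>Extracting the factor \<open>\<rho>\<close> from \<open>D1\<close> cancels every
    denominator; what is left is a polynomial identity in which \<open>r\<close> is the logarithmic
    derivative of \<open>\<rho>\<close>.\<close>
  define h where "h = b * r + a - B"
  have D1: "D1 = \<rho> * h" by (simp add: D1_def h_def R algebra_simps)
  have "(2 * G1\<^sup>2 + 2 * \<rho>\<^sup>2 * G2) / \<rho>\<^sup>2 = 8 * a\<^sup>2 + 2 * G2"
    "4 * \<rho>\<^sup>2 * G1 * D1 / (\<rho>\<^sup>2)\<^sup>2 = 8 * a * h" "(\<rho>\<^sup>2)\<^sup>2 * D2 / (\<rho>\<^sup>2)\<^sup>2 = D2"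
    "2 * (\<rho>\<^sup>2)\<^sup>2 * D1\<^sup>2 / (\<rho>\<^sup>2) ^ 3 = 2 * h\<^sup>2"
    using assms(1) by (simp_all add: G1_def D1 field_simps power2_eq_square power3_eq_cube)
  moreover have "8 * a\<^sup>2 + 2 * G2 - 8 * a * h - D2 + 2 * h\<^sup>2 - (1 - m\<^sup>2) * M2
    = 2 * ((B + 2 * a)\<^sup>2 + (1 - m\<^sup>2) * ((b + \<tau>)\<^sup>2 - \<phi>\<^sup>2))
      + (- 2 * ((A - b) * b + a * (B + a) + (2 * b * (B + a) * r + b\<^sup>2 * (- m\<^sup>2 - r\<^sup>2))
          + (1 - m\<^sup>2) * ((b + \<tau>) * \<tau> + \<phi> * (a - \<phi>)))
        + (R * q + \<rho> * (Q + p)) - 2 * (- m\<^sup>2 * \<rho> * \<zeta> + R * (q + \<eta>))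
        + 2 * (R * \<eta> + \<rho> * (p - \<zeta>)) - (1 - m\<^sup>2) * (g - \<rho> * \<zeta>))"
    unfolding G2_def D2_def M2_def h_def R by (simp add: algebra_simps power2_eq_square)
  ultimately show ?thesis by (simp add: r_def)
qed

text \<open>The second variation with the curve parametrised by the tangent angle of the unperturbed
  curve: \<open>z i j\<close> carries \<open>i\<close> angle and \<open>j\<close> time derivatives.
  For t different from 0 the parameter is merely a label. The integrand of the second derivative is
  twice the quadratic form of \<open>stability_form_coercive\<close> plus an exact derivative whose
  boundary contribution is nonnegative.\<close>

lemma second_variation_angle_coercive:
  fixes x y :: "nat \<Rightarrow> nat \<Rightarrow> real \<Rightarrow> real \<Rightarrow> real" and \<rho> R u u1 u2 E :: "real \<Rightarrow> real"
  defines "I \<equiv> {-pi..pi}"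
  assumes d: "d > 0" and m: "0 < m" "m \<le> 1"
    and dt: "\<And>z i j \<theta> t. z \<in> {x, y} \<Longrightarrow> i \<le> 2 \<Longrightarrow> \<theta> \<in> I \<Longrightarrow> t \<in> {-d<..<d} \<Longrightarrow>
        (z i j \<theta> has_real_derivative z i (Suc j) \<theta> t) (at t)"
    and dang: "\<And>z i j \<theta>. z \<in> {x, y} \<Longrightarrow> i \<le> 1 \<Longrightarrow> \<theta> \<in> I \<Longrightarrow>
        ((\<lambda>\<theta>. z i j \<theta> 0) has_real_derivative z (Suc i) j \<theta> 0) (at \<theta> within I)"
    and cont: "\<And>z i j. z \<in> {x, y} \<Longrightarrow> i \<le> 2 \<Longrightarrow>
        continuous_on ({-d<..<d} \<times> I) (\<lambda>p. z i j (snd p) (fst p))"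
    and convex: "\<And>\<theta> t. \<theta> \<in> I \<Longrightarrow> t \<in> {-d<..<d} \<Longrightarrow>
        x 1 0 \<theta> t * y 2 0 \<theta> t - y 1 0 \<theta> t * x 2 0 \<theta> t > 0"
    and rho: "\<And>\<theta>. \<theta> \<in> I \<Longrightarrow> \<rho> \<theta> > 0"
      "\<And>\<theta>. \<theta> \<in> I \<Longrightarrow> (\<rho> has_real_derivative R \<theta>) (at \<theta> within I)"
      "\<And>\<theta>. \<theta> \<in> I \<Longrightarrow> (R has_real_derivative - m\<^sup>2 * \<rho> \<theta>) (at \<theta> within I)"
    and tangent: "\<And>\<theta>. \<theta> \<in> I \<Longrightarrow> x 1 0 \<theta> 0 = - \<rho> \<theta> * cos \<theta>"
      "\<And>\<theta>. \<theta> \<in> I \<Longrightarrow> y 1 0 \<theta> 0 = - \<rho> \<theta> * sin \<theta>"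
    and ends: "\<And>z j \<theta>. z \<in> {x, y} \<Longrightarrow> \<theta> \<in> {-pi, pi} \<Longrightarrow> j \<in> {1, 2} \<Longrightarrow> z 0 j \<theta> 0 = 0"
      "y 1 1 (-pi) 0 = 0" "y 1 1 pi 0 = 0" "y 1 2 (-pi) 0 \<ge> 0" "y 1 2 pi 0 \<le> 0"
    and E: "\<And>t. t \<in> {-d<..<d} \<Longrightarrow> E t = integral I (\<lambda>\<theta>.
        ((x 1 0 \<theta> t)\<^sup>2 + (y 1 0 \<theta> t)\<^sup>2)\<^sup>2 / (x 1 0 \<theta> t * y 2 0 \<theta> t - y 1 0 \<theta> t * x 2 0 \<theta> t)
        - (1 - m\<^sup>2) * (x 0 0 \<theta> t * y 1 0 \<theta> t - x 1 0 \<theta> t * y 0 0 \<theta> t))"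
    and u: "\<And>\<theta>. \<theta> \<in> I \<Longrightarrow> u \<theta> = - sin \<theta> * x 0 1 \<theta> 0 + cos \<theta> * y 0 1 \<theta> 0"
      "\<And>\<theta>. \<theta> \<in> I \<Longrightarrow> (u has_real_derivative u1 \<theta>) (at \<theta> within I)"
      "\<And>\<theta>. \<theta> \<in> I \<Longrightarrow> (u1 has_real_derivative u2 \<theta>) (at \<theta> within I)"
  shows "deriv (deriv E) 0 \<ge> 2 * m\<^sup>2 / (2 + 6 * pi * exp (2 * pi)) *
      integral I (\<lambda>\<theta>. (u \<theta>)\<^sup>2 + (u1 \<theta>)\<^sup>2 + (u2 \<theta>)\<^sup>2)"
proof -
  define T where "T = {-d<..<d}"
  have T0: "0 \<in> T" using d by (simp add: T_def)
  define c where "c = 1 - m\<^sup>2"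
  have uniq: "f' = f''" if "\<theta> \<in> I" "(f has_real_derivative f') (at \<theta> within I)"
    "(f has_real_derivative f'') (at \<theta> within I)" for f :: "real \<Rightarrow> real" and f' f'' \<theta>
    using vector_derivative_unique_within_closed_interval[of "-pi" pi \<theta> f f' f''] that
    by (simp add: I_def has_real_derivative_iff_has_vector_derivative)
  \<comment> \<open>These are the components of the derivatives, not the derivatives of the
    components. The frame turns by T' = -N and N' = T, hence the extra terms in \<open>dtg\<close>
    and \<open>dnr\<close>.\<close>
  define tg where "tg i j \<theta> = - cos \<theta> * x i j \<theta> 0 - sin \<theta> * y i j \<theta> 0" for i j \<theta>
  define nr where "nr i j \<theta> = - sin \<theta> * x i j \<theta> 0 + cos \<theta> * y i j \<theta> 0" for i j \<theta>
  have dx: "((\<lambda>\<theta>. x i j \<theta> 0) has_real_derivative x (Suc i) j \<theta> 0) (at \<theta> within I)"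
    and dy: "((\<lambda>\<theta>. y i j \<theta> 0) has_real_derivative y (Suc i) j \<theta> 0) (at \<theta> within I)"
    if "i \<le> 1" "\<theta> \<in> I" for i j \<theta>
    using that by (auto intro: dang)
  have dtg: "(tg i j has_real_derivative tg (Suc i) j \<theta> - nr i j \<theta>) (at \<theta> within I)"
    if "i \<le> 1" "\<theta> \<in> I" for i j \<theta>
    unfolding tg_def[abs_def] nr_def
    by (rule derivative_eq_intros dx dy that refl)+ (simp add: algebra_simps)
  have dnr: "(nr i j has_real_derivative nr (Suc i) j \<theta> + tg i j \<theta>) (at \<theta> within I)"
    if "i \<le> 1" "\<theta> \<in> I" for i j \<theta>
    unfolding nr_def[abs_def] tg_def
    by (rule derivative_eq_intros dx dy that refl)+ (simp add: algebra_simps)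

  \<comment> \<open>Differentiating the energy twice in time under the integral\<close>
  define G where "G t \<theta> = (x 1 0 \<theta> t)\<^sup>2 + (y 1 0 \<theta> t)\<^sup>2" for t \<theta>
  define G1 where "G1 t \<theta> = 2 * (x 1 0 \<theta> t * x 1 1 \<theta> t + y 1 0 \<theta> t * y 1 1 \<theta> t)" for t \<theta>
  define G2 where "G2 t \<theta> = 2 * ((x 1 1 \<theta> t)\<^sup>2 + (y 1 1 \<theta> t)\<^sup>2)
      + 2 * (x 1 0 \<theta> t * x 1 2 \<theta> t + y 1 0 \<theta> t * y 1 2 \<theta> t)" for t \<theta>
  define D where "D t \<theta> = x 1 0 \<theta> t * y 2 0 \<theta> t - y 1 0 \<theta> t * x 2 0 \<theta> t" for t \<theta>
  define D1 where "D1 t \<theta> = (x 1 1 \<theta> t * y 2 0 \<theta> t - y 1 1 \<theta> t * x 2 0 \<theta> t)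
      + (x 1 0 \<theta> t * y 2 1 \<theta> t - y 1 0 \<theta> t * x 2 1 \<theta> t)" for t \<theta>
  define D2 where "D2 t \<theta> = (x 1 2 \<theta> t * y 2 0 \<theta> t - y 1 2 \<theta> t * x 2 0 \<theta> t)
      + 2 * (x 1 1 \<theta> t * y 2 1 \<theta> t - y 1 1 \<theta> t * x 2 1 \<theta> t)
      + (x 1 0 \<theta> t * y 2 2 \<theta> t - y 1 0 \<theta> t * x 2 2 \<theta> t)" for t \<theta>
  define M where "M t \<theta> = x 0 0 \<theta> t * y 1 0 \<theta> t - x 1 0 \<theta> t * y 0 0 \<theta> t" for t \<theta>
  define M1 where "M1 t \<theta> = (x 0 1 \<theta> t * y 1 0 \<theta> t - y 0 1 \<theta> t * x 1 0 \<theta> t)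
      + (x 0 0 \<theta> t * y 1 1 \<theta> t - y 0 0 \<theta> t * x 1 1 \<theta> t)" for t \<theta>
  define M2 where "M2 t \<theta> = (x 0 2 \<theta> t * y 1 0 \<theta> t - y 0 2 \<theta> t * x 1 0 \<theta> t)
      + 2 * (x 0 1 \<theta> t * y 1 1 \<theta> t - y 0 1 \<theta> t * x 1 1 \<theta> t)
      + (x 0 0 \<theta> t * y 1 2 \<theta> t - y 0 0 \<theta> t * x 1 2 \<theta> t)" for t \<theta>
  note defs = G_def G1_def G2_def D_def D1_def D2_def M_def M1_def M2_def
  define f where "f t \<theta> = (G t \<theta>)\<^sup>2 / D t \<theta> - c * M t \<theta>" for t \<theta>
  define f1 where "f1 t \<theta> = 2 * G t \<theta> * G1 t \<theta> / D t \<theta>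
      - (G t \<theta>)\<^sup>2 * D1 t \<theta> / (D t \<theta>)\<^sup>2 - c * M1 t \<theta>" for t \<theta>
  define f2 where "f2 t \<theta> = (2 * (G1 t \<theta>)\<^sup>2 + 2 * G t \<theta> * G2 t \<theta>) / D t \<theta>
      - 4 * G t \<theta> * G1 t \<theta> * D1 t \<theta> / (D t \<theta>)\<^sup>2 - (G t \<theta>)\<^sup>2 * D2 t \<theta> / (D t \<theta>)\<^sup>2
      + 2 * (G t \<theta>)\<^sup>2 * (D1 t \<theta>)\<^sup>2 / (D t \<theta>) ^ 3 - c * M2 t \<theta>" for t \<theta>
  have Dpos: "D t \<theta> > 0" if "\<theta> \<in> I" "t \<in> T" for t \<theta>
    using convex that by (simp add: D_def T_def)

  have dxt: "(x i j \<theta> has_real_derivative x i (Suc j) \<theta> t) (at t)"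
    and dyt: "(y i j \<theta> has_real_derivative y i (Suc j) \<theta> t) (at t)"
    if "i \<le> 2" "\<theta> \<in> I" "t \<in> T" for i j \<theta> t
    using that by (auto intro: dt simp: T_def)
  have dGDM: "((\<lambda>t. G t \<theta>) has_real_derivative G1 t \<theta>) (at t)"
    "((\<lambda>t. G1 t \<theta>) has_real_derivative G2 t \<theta>) (at t)"
    "((\<lambda>t. D t \<theta>) has_real_derivative D1 t \<theta>) (at t)"
    "((\<lambda>t. D1 t \<theta>) has_real_derivative D2 t \<theta>) (at t)"
    "((\<lambda>t. M t \<theta>) has_real_derivative M1 t \<theta>) (at t)"
    "((\<lambda>t. M1 t \<theta>) has_real_derivative M2 t \<theta>) (at t)"
    if "\<theta> \<in> I" "t \<in> T" for \<theta> t
    unfolding defs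
    by (rule DERIV_cong, ((rule derivative_intros dxt dyt that | (simp; fail))+)[1],
        simp add: algebra_simps power2_eq_square numeral_2_eq_2)+
  have cx: "continuous_on (T \<times> I) (\<lambda>p. x i j (snd p) (fst p))"
    and cy: "continuous_on (T \<times> I) (\<lambda>p. y i j (snd p) (fst p))" if "i \<le> 2" for i j
    using cont that by (auto simp: T_def)
  have cGDM: "continuous_on (T \<times> I) (\<lambda>p. G (fst p) (snd p))"
    "continuous_on (T \<times> I) (\<lambda>p. G1 (fst p) (snd p))"
    "continuous_on (T \<times> I) (\<lambda>p. G2 (fst p) (snd p))"
    "continuous_on (T \<times> I) (\<lambda>p. D (fst p) (snd p))"
    "continuous_on (T \<times> I) (\<lambda>p. D1 (fst p) (snd p))"
    "continuous_on (T \<times> I) (\<lambda>p. D2 (fst p) (snd p))"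
    "continuous_on (T \<times> I) (\<lambda>p. M (fst p) (snd p))"
    "continuous_on (T \<times> I) (\<lambda>p. M1 (fst p) (snd p))"
    "continuous_on (T \<times> I) (\<lambda>p. M2 (fst p) (snd p))"
    unfolding defs by (intro continuous_intros cx cy; simp)+
  have Dne: "\<forall>p\<in>T \<times> I. D (fst p) (snd p) \<noteq> 0" using Dpos by fastforce
  have cf: "continuous_on (T \<times> I) (\<lambda>p. f (fst p) (snd p))"
    "continuous_on (T \<times> I) (\<lambda>p. f1 (fst p) (snd p))"
    "continuous_on (T \<times> I) (\<lambda>p. f2 (fst p) (snd p))"
    unfolding f_def f1_def f2_def using Dne by (intro continuous_intros cGDM; auto)+
  have second: "deriv (deriv E) 0 = integral I (f2 0)"
    unfolding I_def
  proof (rule second_deriv_integral[OF d, where f = f and ?f1.0 = f1])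
    fix t \<theta> assume t: "t \<in> {-d<..<d}" and \<theta>: "\<theta> \<in> {-pi..pi}"
    then have tI: "\<theta> \<in> I" "t \<in> T" by (auto simp: I_def T_def)
    have Dn: "D t \<theta> \<noteq> 0" using Dpos[OF tI] by simp
    note Q = quotient_second_derivative[where G = "\<lambda>t. G t \<theta>" and ?G1.0 = "\<lambda>t. G1 t \<theta>"
        and ?G2.0 = "\<lambda>t. G2 t \<theta>" and D = "\<lambda>t. D t \<theta>" and ?D1.0 = "\<lambda>t. D1 t \<theta>"
        and ?D2.0 = "\<lambda>t. D2 t \<theta>" and M = "\<lambda>t. M t \<theta>" and ?M1.0 = "\<lambda>t. M1 t \<theta>"
        and ?M2.0 = "\<lambda>t. M2 t \<theta>" and t = t, OF dGDM[OF tI] Dn]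
    show "((\<lambda>t. f t \<theta>) has_real_derivative f1 t \<theta>) (at t)"
      unfolding f_def f1_def
      by (rule Q(1))
    show "((\<lambda>t. f1 t \<theta>) has_real_derivative f2 t \<theta>) (at t)"
      unfolding f1_def f2_def
      by (rule Q(2))
  next
    fix t assume "t \<in> {-d<..<d}"
    then show "E t = integral {-pi..pi} (f t)"
      by (subst E) (auto simp: f_def[abs_def] defs c_def I_def)
  qed (use cf in \<open>auto simp: I_def T_def\<close>)

  \<comment> \<open>The integrand at time zero in the moving frame\<close>
  have q: "x 2 0 \<theta> 0 = - R \<theta> * cos \<theta> + \<rho> \<theta> * sin \<theta>"
    "y 2 0 \<theta> 0 = - R \<theta> * sin \<theta> - \<rho> \<theta> * cos \<theta>" if "\<theta> \<in> I" for \<theta>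
  proof -
    have "((\<lambda>\<theta>. - \<rho> \<theta> * cos \<theta>) has_real_derivative x (Suc 1) 0 \<theta> 0) (at \<theta> within I)"
      by (rule has_field_derivative_transform_within[OF dx zero_less_one])
        (use that tangent in auto)
    moreover have "((\<lambda>\<theta>. - \<rho> \<theta> * cos \<theta>) has_real_derivative
        - R \<theta> * cos \<theta> + \<rho> \<theta> * sin \<theta>) (at \<theta> within I)"
      by (rule derivative_eq_intros rho(2) that refl | simp)+
    ultimately show "x 2 0 \<theta> 0 = - R \<theta> * cos \<theta> + \<rho> \<theta> * sin \<theta>"
      using uniq[OF that] by (metis Suc_1)
    have "((\<lambda>\<theta>. - \<rho> \<theta> * sin \<theta>) has_real_derivative y (Suc 1) 0 \<theta> 0) (at \<theta> within I)"
      by (rule has_field_derivative_transform_within[OF dy zero_less_one])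
        (use that tangent in auto)
    moreover have "((\<lambda>\<theta>. - \<rho> \<theta> * sin \<theta>) has_real_derivative
        - R \<theta> * sin \<theta> - \<rho> \<theta> * cos \<theta>) (at \<theta> within I)"
      by (rule derivative_eq_intros rho(2) that refl | simp)+
    ultimately show "y 2 0 \<theta> 0 = - R \<theta> * sin \<theta> - \<rho> \<theta> * cos \<theta>"
      using uniq[OF that] by (metis Suc_1)
  qed

  \<comment> \<open>The terms with time index 2 come from the acceleration, which enters the second
    variation through the first variation. Since the curve is critical, they form a pure divergence
    and can be collected here.\<close>
  define Bd where "Bd \<theta> = - 2 * (tg 1 1 \<theta> * nr 1 1 \<theta> + (nr 1 1 \<theta>)\<^sup>2 * (R \<theta> / \<rho> \<theta>)
        + c * (nr 0 1 \<theta> * tg 0 1 \<theta>))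
      + \<rho> \<theta> * nr 1 2 \<theta> - 2 * (R \<theta> * nr 0 2 \<theta>) + 2 * (\<rho> \<theta> * tg 0 2 \<theta>)
      - c * (x 0 0 \<theta> 0 * y 0 2 \<theta> 0 - y 0 0 \<theta> 0 * x 0 2 \<theta> 0)" for \<theta>
  define Bd' where "Bd' \<theta> = - 2 * ((tg 2 1 \<theta> - nr 1 1 \<theta>) * nr 1 1 \<theta>
          + tg 1 1 \<theta> * (nr 2 1 \<theta> + tg 1 1 \<theta>)
          + (2 * nr 1 1 \<theta> * (nr 2 1 \<theta> + tg 1 1 \<theta>) * (R \<theta> / \<rho> \<theta>)
            + (nr 1 1 \<theta>)\<^sup>2 * (- m\<^sup>2 - (R \<theta> / \<rho> \<theta>)\<^sup>2))
          + c * ((nr 1 1 \<theta> + tg 0 1 \<theta>) * tg 0 1 \<theta> + nr 0 1 \<theta> * (tg 1 1 \<theta> - nr 0 1 \<theta>)))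
        + (R \<theta> * nr 1 2 \<theta> + \<rho> \<theta> * (nr 2 2 \<theta> + tg 1 2 \<theta>))
        - 2 * (- m\<^sup>2 * \<rho> \<theta> * nr 0 2 \<theta> + R \<theta> * (nr 1 2 \<theta> + tg 0 2 \<theta>))
        + 2 * (R \<theta> * tg 0 2 \<theta> + \<rho> \<theta> * (tg 1 2 \<theta> - nr 0 2 \<theta>))
        - c * (x 0 0 \<theta> 0 * y 1 2 \<theta> 0 - y 0 0 \<theta> 0 * x 1 2 \<theta> 0 - \<rho> \<theta> * nr 0 2 \<theta>)" for \<theta>
  have dBd: "(Bd has_real_derivative Bd' \<theta>) (at \<theta> within I)" if \<theta>: "\<theta> \<in> I" for \<theta>
  proof -
    \<comment> \<open>The Euler-Lagrange equation rho'' = -m^2 rho enters here as a Riccati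
      equation, and again when \<open>R\<close> itself is differentiated.\<close>
    have dr: "((\<lambda>\<theta>. R \<theta> / \<rho> \<theta>) has_real_derivative - m\<^sup>2 - (R \<theta> / \<rho> \<theta>)\<^sup>2) (at \<theta> within I)"
      using rho(1)[OF \<theta>]
      by (auto intro!: derivative_eq_intros rho(2,3)[OF \<theta>] simp: field_simps power2_eq_square)
    have "((\<lambda>\<theta>. x 0 0 \<theta> 0 * y 0 2 \<theta> 0 - y 0 0 \<theta> 0 * x 0 2 \<theta> 0) has_real_derivative
        x 0 0 \<theta> 0 * y 1 2 \<theta> 0 - y 0 0 \<theta> 0 * x 1 2 \<theta> 0 - \<rho> \<theta> * nr 0 2 \<theta>) (at \<theta> within I)"
      by (rule derivative_eq_intros dx dy \<theta> refl | simp)+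
        (simp add: nr_def tangent \<theta> tangent[OF \<theta>, unfolded One_nat_def] algebra_simps)
    note d = this dr dtg[of 1, OF _ \<theta>, simplified] dtg[of 0, OF _ \<theta>, simplified]
      dnr[of 1, OF _ \<theta>, simplified] dnr[of 0, OF _ \<theta>, simplified] rho(2,3)[OF \<theta>]
    show ?thesis
      unfolding Bd_def[abs_def] Bd'_def
      by (rule derivative_eq_intros d refl | simp)+ (simp add: numeral_2_eq_2 algebra_simps)
  qed
  have density: "f2 0 \<theta> = 2 * ((nr 2 1 \<theta> + 2 * tg 1 1 \<theta>)\<^sup>2
      + c * ((nr 1 1 \<theta> + tg 0 1 \<theta>)\<^sup>2 - (nr 0 1 \<theta>)\<^sup>2)) + Bd' \<theta>" if \<theta>: "\<theta> \<in> I" for \<theta>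
  proof -
    have CS: "(cos \<theta>)\<^sup>2 + (sin \<theta>)\<^sup>2 = 1" by simp
    note t = tangent[OF \<theta>] q[OF \<theta>]
    have G: "G 0 \<theta> = (\<rho> \<theta>)\<^sup>2"
    proof -
      have "G 0 \<theta> = (\<rho> \<theta>)\<^sup>2 * ((cos \<theta>)\<^sup>2 + (sin \<theta>)\<^sup>2)"
        by (simp only: G_def t power_mult_distrib power2_minus distrib_left)
      then show ?thesis by simp
    qed
    have D: "D 0 \<theta> = (\<rho> \<theta>)\<^sup>2"
    proof -
      have "D 0 \<theta> = (\<rho> \<theta>)\<^sup>2 * ((cos \<theta>)\<^sup>2 + (sin \<theta>)\<^sup>2)"
        by (simp only: D_def t) (simp only: algebra_simps power2_eq_square minus_minus)
      then show ?thesis by simp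
    qed
    have G1: "G1 0 \<theta> = 2 * (\<rho> \<theta> * tg 1 1 \<theta>)"
      by (simp only: G1_def t tg_def) (simp add: algebra_simps)
    have G2: "G2 0 \<theta> = 2 * ((tg 1 1 \<theta>)\<^sup>2 + (nr 1 1 \<theta>)\<^sup>2) + 2 * (\<rho> \<theta> * tg 1 2 \<theta>)"
      using frame_dot_det(1)[OF CS, of "x 1 1 \<theta> 0" "y 1 1 \<theta> 0" "x 1 1 \<theta> 0" "y 1 1 \<theta> 0"]
      unfolding G2_def t power2_eq_square tg_def nr_def by (simp add: algebra_simps)
    have D1: "D1 0 \<theta> = nr 1 1 \<theta> * R \<theta> + tg 1 1 \<theta> * \<rho> \<theta> - \<rho> \<theta> * nr 2 1 \<theta>"
      by (simp only: D1_def t tg_def nr_def) (simp add: algebra_simps)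
    have "(x 1 2 \<theta> 0 * y 2 0 \<theta> 0 - y 1 2 \<theta> 0 * x 2 0 \<theta> 0)
        = nr 1 2 \<theta> * R \<theta> + tg 1 2 \<theta> * \<rho> \<theta>"
      "(x 1 0 \<theta> 0 * y 2 2 \<theta> 0 - y 1 0 \<theta> 0 * x 2 2 \<theta> 0) = - \<rho> \<theta> * nr 2 2 \<theta>"
      by (simp only: t tg_def nr_def, simp add: algebra_simps)+
    then have D2: "D2 0 \<theta> = nr 1 2 \<theta> * R \<theta> + tg 1 2 \<theta> * \<rho> \<theta>
        + 2 * (nr 1 1 \<theta> * tg 2 1 \<theta> - tg 1 1 \<theta> * nr 2 1 \<theta>) - \<rho> \<theta> * nr 2 2 \<theta>"
      using frame_dot_det(2)[OF CS, of "x 1 1 \<theta> 0" "y 1 1 \<theta> 0" "x 2 1 \<theta> 0" "y 2 1 \<theta> 0"]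
      unfolding D2_def by (simp add: tg_def nr_def)
    have "(x 0 2 \<theta> 0 * y 1 0 \<theta> 0 - y 0 2 \<theta> 0 * x 1 0 \<theta> 0) = nr 0 2 \<theta> * \<rho> \<theta>"
      by (simp only: t tg_def nr_def, simp add: algebra_simps)
    then have M2: "M2 0 \<theta> = nr 0 2 \<theta> * \<rho> \<theta>
        + 2 * (nr 0 1 \<theta> * tg 1 1 \<theta> - tg 0 1 \<theta> * nr 1 1 \<theta>)
        + (x 0 0 \<theta> 0 * y 1 2 \<theta> 0 - y 0 0 \<theta> 0 * x 1 2 \<theta> 0)"
      using frame_dot_det(2)[OF CS, of "x 0 1 \<theta> 0" "y 0 1 \<theta> 0" "x 1 1 \<theta> 0" "y 1 1 \<theta> 0"]
      unfolding M2_def by (simp add: tg_def nr_def)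
    show ?thesis
      unfolding f2_def G D G1 G2 D1 D2 M2 Bd'_def c_def
      by (rule second_variation_density) (use rho(1)[OF \<theta>] in simp)
  qed

  \<comment> \<open>The quadratic form in the normal velocity and the boundary terms\<close>
  have u_nr: "u \<theta> = nr 0 1 \<theta>" if "\<theta> \<in> I" for \<theta> using u(1)[OF that] by (simp add: nr_def)
  have u1: "u1 \<theta> = nr 1 1 \<theta> + tg 0 1 \<theta>" if "\<theta> \<in> I" for \<theta>
  proof (rule uniq[OF that u(2)[OF that]])
    have "(nr 0 1 has_real_derivative nr 1 1 \<theta> + tg 0 1 \<theta>) (at \<theta> within I)"
      using dnr[of 0 \<theta> 1] that by simp
    then show "(u has_real_derivative nr 1 1 \<theta> + tg 0 1 \<theta>) (at \<theta> within I)"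
      by (rule has_field_derivative_transform_within[OF _ zero_less_one]) (use that u_nr in auto)
  qed
  \<comment> \<open>Adding u cancels the last term, so u + u'' is the quantity squared in
    \<open>density\<close>.\<close>
  have u2: "u2 \<theta> = nr 2 1 \<theta> + 2 * tg 1 1 \<theta> - nr 0 1 \<theta>" if "\<theta> \<in> I" for \<theta>
  proof (rule uniq[OF that u(3)[OF that]])
    have "((\<lambda>\<theta>. nr 1 1 \<theta> + tg 0 1 \<theta>) has_real_derivative
        nr 2 1 \<theta> + 2 * tg 1 1 \<theta> - nr 0 1 \<theta>) (at \<theta> within I)"
      using DERIV_add[OF dnr[of 1 \<theta> 1] dtg[of 0 \<theta> 1]] that
      by (simp add: numeral_2_eq_2 algebra_simps)
    then show "(u1 has_real_derivative nr 2 1 \<theta> + 2 * tg 1 1 \<theta> - nr 0 1 \<theta>) (at \<theta> within I)"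
      by (rule has_field_derivative_transform_within[OF _ zero_less_one]) (use that u1 in auto)
  qed
  have cz: "continuous_on I (\<lambda>\<theta>. z i j \<theta> 0)" if "z \<in> {x, y}" "i \<le> 2" for z i j
  proof -
    have "continuous_on I (Pair (0::real))" "Pair 0 ` I \<subseteq> {-d<..<d} \<times> I"
      using T0 by (auto simp: T_def intro!: continuous_intros)
    from continuous_on_compose2[OF cont[OF that] this] show ?thesis by simp
  qed
  have ctn: "continuous_on I (tg i j)" "continuous_on I (nr i j)" if "i \<le> 2" for i j
    unfolding tg_def[abs_def] nr_def[abs_def] by (intro continuous_intros cz; use that in simp)+
  have cu2: "continuous_on I u2"
    by (rule continuous_on_eq[of _ "\<lambda>\<theta>. nr 2 1 \<theta> + 2 * tg 1 1 \<theta> - nr 0 1 \<theta>"])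
      (auto intro!: continuous_intros ctn simp: u2)
  have cu: "continuous_on I u" "continuous_on I u1"
    using u(2,3) by (auto intro: DERIV_continuous_on)
  have pm: "-pi \<in> I" "pi \<in> I" by (auto simp: I_def)
  have e: "tg 0 j \<theta> = 0" "nr 0 j \<theta> = 0" if "\<theta> \<in> {-pi, pi}" "j \<in> {1, 2}" for j \<theta>
    using ends(1)[of x, OF _ that] ends(1)[of y, OF _ that] by (simp_all add: tg_def nr_def)
  \<comment> \<open>At both ends sin = 0 and cos = -1, so normal components are negated ordinates.
    \<open>tg 1 1\<close> is free there, but in \<open>Bd\<close> it is multiplied by
    \<open>nr 1 1\<close>, so only the acceleration term with its known sign survives.\<close>
  have nr1: "nr 1 1 (-pi) = 0" "nr 1 1 pi = 0" using ends by (simp_all add: nr_def)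
  have nr2: "nr 1 2 (-pi) \<le> 0" "nr 1 2 pi \<ge> 0" using ends by (simp_all add: nr_def)
  have Bd: "Bd \<theta> = \<rho> \<theta> * nr 1 2 \<theta>" if "\<theta> \<in> {-pi, pi}" for \<theta>
    using that nr1 e[OF that] ends(1)[of x, OF _ that] ends(1)[of y, OF _ that]
    by (auto simp: Bd_def)
  have "0 \<le> Bd pi - Bd (-pi)"
    using nr2 rho(1)[OF pm(1)] rho(1)[OF pm(2)] by (simp add: Bd mult_le_0_iff add_nonneg_nonneg
        order_trans[of _ 0])
  also have "\<dots> \<le> integral I (\<lambda>\<theta>. f2 0 \<theta> - 2 * ((u \<theta> + u2 \<theta>)\<^sup>2 + c * ((u1 \<theta>)\<^sup>2 - (u \<theta>)\<^sup>2)))"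
    unfolding I_def
  proof (rule boundary_le_integral)
    have "continuous_on I (\<lambda>\<theta>. f2 (fst (0, \<theta>)) (snd (0::real, \<theta>)))"
      by (rule continuous_on_compose2[OF cf(3)]) (use T0 in \<open>auto intro!: continuous_intros\<close>)
    then have "continuous_on I (f2 0)" by simp
    then show "continuous_on {-pi..pi}
        (\<lambda>\<theta>. f2 0 \<theta> - 2 * ((u \<theta> + u2 \<theta>)\<^sup>2 + c * ((u1 \<theta>)\<^sup>2 - (u \<theta>)\<^sup>2)))"
      unfolding I_def[symmetric] by (intro continuous_intros cu cu2)
    fix \<theta> assume "\<theta> \<in> {-pi..pi}"
    then have \<theta>: "\<theta> \<in> I" by (simp add: I_def)
    show "(Bd has_real_derivative Bd' \<theta>) (at \<theta> within {-pi..pi})"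
      using dBd[OF \<theta>] by (simp add: I_def)
    show "Bd' \<theta> \<le> f2 0 \<theta> - 2 * ((u \<theta> + u2 \<theta>)\<^sup>2 + c * ((u1 \<theta>)\<^sup>2 - (u \<theta>)\<^sup>2))"
      by (simp add: density[OF \<theta>] u_nr[OF \<theta>] u1[OF \<theta>] u2[OF \<theta>])
  qed simp
  also have "\<dots> = integral I (f2 0)
      - 2 * integral I (\<lambda>\<theta>. (u \<theta> + u2 \<theta>)\<^sup>2 + c * ((u1 \<theta>)\<^sup>2 - (u \<theta>)\<^sup>2))"
  proof -
    have "continuous_on I (\<lambda>\<theta>. f2 (fst (0, \<theta>)) (snd (0::real, \<theta>)))"
      by (rule continuous_on_compose2[OF cf(3)]) (use T0 in \<open>auto intro!: continuous_intros\<close>)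
    then have "f2 0 integrable_on I" by (simp add: I_def integrable_continuous_real)
    moreover have "(\<lambda>\<theta>. 2 * ((u \<theta> + u2 \<theta>)\<^sup>2 + c * ((u1 \<theta>)\<^sup>2 - (u \<theta>)\<^sup>2))) integrable_on I"
      using cu cu2 unfolding I_def by (intro integrable_continuous_real continuous_intros)
    ultimately show ?thesis by (subst integral_diff) (simp_all del: distrib_left_numeral)
  qed
  finally have "2 * integral I (\<lambda>\<theta>. (u \<theta> + u2 \<theta>)\<^sup>2 + c * ((u1 \<theta>)\<^sup>2 - (u \<theta>)\<^sup>2))
      \<le> deriv (deriv E) 0"
    unfolding second by simp
  moreover have "m\<^sup>2 / (2 + 6 * pi * exp (2 * pi)) *
        integral I (\<lambda>\<theta>. (u \<theta>)\<^sup>2 + (u1 \<theta>)\<^sup>2 + (u2 \<theta>)\<^sup>2)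
      \<le> integral I (\<lambda>\<theta>. (u \<theta> + u2 \<theta>)\<^sup>2 + c * ((u1 \<theta>)\<^sup>2 - (u \<theta>)\<^sup>2))"
    unfolding I_def c_def
    by (rule stability_form_coercive)
      (use u(2,3) cu2 m pm e nr1 in \<open>simp_all add: I_def u_nr u1\<close>)
  ultimately show ?thesis by simp
qed

section \<open>The curve in the tangent angle\<close>

text \<open>The curve \<open>\<gamma>(x\<^sub>0, L)\<close> in terms of its tangent angle \<open>\<theta> \<in> [-\<pi>, \<pi>]\<close>: \<open>spos\<close> is the
  arc length position, \<open>rad\<close> the radius of curvature and \<open>m = \<sigma> / \<pi>\<close>.\<close>

locale gamma_curve =
  fixes x0 L :: real
  assumes x0: "x0 > 0" and L: "L > 3 * x0"
begin

definition m :: real where "m = sqrt (x0 / (L + x0))"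
definition k :: real where "k = gk x0 L"
definition spos :: "real \<Rightarrow> real" where "spos \<theta> = L + k * sin (m * \<theta>)"
definition rad :: "real \<Rightarrow> real" where "rad \<theta> = k * m * cos (m * \<theta>)"
definition rad' :: "real \<Rightarrow> real" where "rad' \<theta> = - k * m\<^sup>2 * sin (m * \<theta>)"

lemma sigma: "gsigma x0 L = m * pi"
  by (simp add: gsigma_def m_def)

lemma m_sq: "m\<^sup>2 = x0 / (L + x0)"
  using x0 L by (simp add: m_def)

lemma m_pos: "0 < m"
  using x0 L by (simp add: m_def)

text \<open>The assumption L > 3 x0 says precisely that m^2 < 1/4. It keeps m theta inside (-pi/2,
  pi/2), where the radius of curvature is positive and arcsin inverts the sine.\<close>

lemma m_less: "m < 1/2"
proof (rule power2_less_imp_less)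
  show "m\<^sup>2 < (1/2)\<^sup>2" unfolding m_sq using x0 L by (simp add: field_simps power2_eq_square)
qed simp

lemma lambda: "glambda x0 L = 2 * (1 - m\<^sup>2)"
  unfolding m_sq glambda_def using x0 L by (simp add: field_simps)

lemma sin_sigma_pos: "0 < sin (m * pi)"
  using m_pos m_less by (intro sin_gt_zero) auto

lemma k_pos: "0 < k"
  using x0 L sin_sigma_pos by (simp add: k_def gk_def sigma)

lemma k_sin: "k * sin (m * pi) = L"
  using sin_sigma_pos by (simp add: k_def gk_def sigma)

lemma spos_ends: "spos (-pi) = 0" "spos pi = 2 * L"
  by (simp_all add: spos_def k_sin)

lemma m_angle:
  assumes "\<theta> \<in> {-pi..pi}"
  shows "- (m * pi) \<le> m * \<theta>" "m * \<theta> \<le> m * pi" "- (pi/2) < m * \<theta>" "m * \<theta> < pi/2"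
proof -
  have "m * pi < 1/2 * pi" using m_less pi_gt_zero by (intro mult_strict_right_mono)
  moreover show "m * \<theta> \<le> m * pi" using assms m_pos by simp
  moreover have "m * (-pi) \<le> m * \<theta>" using assms m_pos by (intro mult_left_mono) auto
  then show "- (m * pi) \<le> m * \<theta>" by simp
  ultimately show "- (pi/2) < m * \<theta>" "m * \<theta> < pi/2" by linarith+
qed

lemma spos_range:
  assumes "\<theta> \<in> {-pi..pi}"
  shows "spos \<theta> \<in> {0..2*L}"
proof -
  have s: "m * pi < pi/2" using m_angle(4)[of pi] by simp
  have "sin (m * \<theta>) \<le> sin (m * pi)"
    using m_angle[OF assms] s by (intro sin_monotone_2pi_le) linarith+
  moreover have "sin (- (m * pi)) \<le> sin (m * \<theta>)"
    using m_angle[OF assms] s by (intro sin_monotone_2pi_le) linarith+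
  ultimately have "k * sin (m * \<theta>) \<le> k * sin (m * pi)" "k * sin (- (m * pi)) \<le> k * sin (m * \<theta>)"
    using k_pos by (blast intro: mult_left_mono less_imp_le)+
  then have "k * sin (m * \<theta>) \<le> L" "- L \<le> k * sin (m * \<theta>)"
    by (simp_all add: k_sin)
  then show ?thesis by (simp add: spos_def)
qed

lemma spos_surj:
  assumes "s \<in> {0..2*L}"
  obtains \<theta> where "\<theta> \<in> {-pi..pi}" "s = spos \<theta>"
proof -
  have "continuous_on {-pi..pi} spos"
    unfolding spos_def[abs_def] by (intro continuous_intros)
  then have "\<exists>\<theta>. -pi \<le> \<theta> \<and> \<theta> \<le> pi \<and> spos \<theta> = s"
    using assms by (intro IVT') (auto simp: spos_ends)
  then show ?thesis using that by auto
qed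

lemma rad_pos: "\<theta> \<in> {-pi..pi} \<Longrightarrow> 0 < rad \<theta>"
  using m_angle[of \<theta>] k_pos m_pos by (auto simp: rad_def intro!: mult_pos_pos cos_gt_zero_pi)

lemma spos_deriv: "(spos has_real_derivative rad \<theta>) (at \<theta> within A)"
  unfolding spos_def[abs_def] rad_def by (auto intro!: derivative_eq_intros)

lemma rad_deriv: "(rad has_real_derivative rad' \<theta>) (at \<theta> within A)"
  unfolding rad_def[abs_def] rad'_def
  by (auto intro!: derivative_eq_intros simp: power2_eq_square)

lemma rad'_deriv: "(rad' has_real_derivative - m\<^sup>2 * rad \<theta>) (at \<theta> within A)"
  unfolding rad'_def[abs_def] rad_def
  by (auto intro!: derivative_eq_intros simp: power2_eq_square)

lemma continuous_angle_functions:
  "continuous_on A spos" "continuous_on A rad" "continuous_on A rad'"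
  by (rule DERIV_continuous_on, rule spos_deriv rad_deriv rad'_deriv)+

text \<open>The substitution turns a(s) into m theta, because |m theta| < pi/2, and sigma = m pi
  makes pi cancel from all amplitudes and frequencies.\<close>

lemma gcurve_spos:
  assumes "\<theta> \<in> {-pi..pi}"
  shows "gcurve x0 L (spos \<theta>) =
    (- k/2 * (m/(1+m) * sin ((1+m) * \<theta>) + m/(1-m) * sin ((1-m) * \<theta>)),
     k/2 * (m/(1+m) * cos ((1+m) * \<theta>) + m/(1-m) * cos ((1-m) * \<theta>))
       + x0 / (m * tan (m * pi)))"
proof -
  have "arcsin ((spos \<theta> - L) / gk x0 L) = m * \<theta>"
    using m_angle[OF assms] k_pos by (simp add: spos_def k_def arcsin_sin)
  moreover have "(pi + m * pi) / (m * pi) * (m * \<theta>) = (1 + m) * \<theta>"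
    "(pi - m * pi) / (m * pi) * (m * \<theta>) = (1 - m) * \<theta>"
    using m_pos by (simp_all add: field_simps)
  moreover have "m * pi / (pi + m * pi) = m / (1 + m)" "m * pi / (pi - m * pi) = m / (1 - m)"
    "pi * x0 / (m * pi * tan (m * pi)) = x0 / (m * tan (m * pi))"
  proof -
    have "m * pi / (pi + m * pi) = (pi * m) / (pi * (1 + m))" by (simp add: algebra_simps)
    then show "m * pi / (pi + m * pi) = m / (1 + m)" by simp
    have "m * pi / (pi - m * pi) = (pi * m) / (pi * (1 - m))" by (simp add: algebra_simps)
    then show "m * pi / (pi - m * pi) = m / (1 - m)" by simp
    have "pi * x0 / (m * pi * tan (m * pi)) = (pi * x0) / (pi * (m * tan (m * pi)))"
      by (simp add: algebra_simps)
    then show "pi * x0 / (m * pi * tan (m * pi)) = x0 / (m * tan (m * pi))" by simp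
  qed
  ultimately show ?thesis
    unfolding gcurve_def Let_def sigma by (simp only: k_def[symmetric])
qed

text \<open>The amplitudes m/(1+m) and m/(1-m) cancel the frequencies on differentiation, and the
  sum-to-product formulas leave rho times (-cos theta, -sin theta). As rho is also the derivative of
  \<open>spos\<close>, the curve has unit speed, and theta is its tangent angle shifted by
  pi.\<close>

lemma gcurve_spos_deriv:
  assumes "\<theta> \<in> {-pi..pi}"
  shows "((\<lambda>\<theta>. fst (gcurve x0 L (spos \<theta>))) has_real_derivative - rad \<theta> * cos \<theta>)
      (at \<theta> within {-pi..pi})"
    and "((\<lambda>\<theta>. snd (gcurve x0 L (spos \<theta>))) has_real_derivative - rad \<theta> * sin \<theta>)
      (at \<theta> within {-pi..pi})"
proof -
  have c: "cos ((1+m) * \<theta>) + cos ((1-m) * \<theta>) = 2 * cos \<theta> * cos (m * \<theta>)"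
    "sin ((1+m) * \<theta>) + sin ((1-m) * \<theta>) = 2 * sin \<theta> * cos (m * \<theta>)"
    by (simp_all add: algebra_simps cos_add cos_diff sin_add sin_diff)
  have n: "m/(1+m) * (1+m) = m" "m/(1-m) * (1-m) = m" using m_pos m_less by auto
  have "((\<lambda>\<theta>. - k/2 * (m/(1+m) * sin ((1+m) * \<theta>) + m/(1-m) * sin ((1-m) * \<theta>)))
      has_real_derivative - k/2 * ((m/(1+m) * (1+m)) * cos ((1+m) * \<theta>)
        + (m/(1-m) * (1-m)) * cos ((1-m) * \<theta>))) (at \<theta> within {-pi..pi})"
    by (rule derivative_eq_intros refl)+
      (simp only: algebra_simps mult_1 mult_1_right add_0 add_0_right mult_zero_left mult_zero_right)
  also have "- k/2 * ((m/(1+m) * (1+m)) * cos ((1+m) * \<theta>)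
        + (m/(1-m) * (1-m)) * cos ((1-m) * \<theta>)) = - rad \<theta> * cos \<theta>"
    unfolding n distrib_left[symmetric] c rad_def by simp
  finally show "((\<lambda>\<theta>. fst (gcurve x0 L (spos \<theta>))) has_real_derivative - rad \<theta> * cos \<theta>)
      (at \<theta> within {-pi..pi})"
    by (rule has_field_derivative_transform_within[OF _ zero_less_one assms])
      (simp add: gcurve_spos)
  have "((\<lambda>\<theta>. k/2 * (m/(1+m) * cos ((1+m) * \<theta>) + m/(1-m) * cos ((1-m) * \<theta>))
       + x0 / (m * tan (m * pi)))
      has_real_derivative - k/2 * ((m/(1+m) * (1+m)) * sin ((1+m) * \<theta>)
        + (m/(1-m) * (1-m)) * sin ((1-m) * \<theta>))) (at \<theta> within {-pi..pi})"
    by (rule derivative_eq_intros refl)+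
      (simp only: algebra_simps mult_1 mult_1_right add_0 add_0_right mult_zero_left mult_zero_right)
  also have "- k/2 * ((m/(1+m) * (1+m)) * sin ((1+m) * \<theta>)
        + (m/(1-m) * (1-m)) * sin ((1-m) * \<theta>)) = - rad \<theta> * sin \<theta>"
    unfolding n distrib_left[symmetric] c rad_def by simp
  finally show "((\<lambda>\<theta>. snd (gcurve x0 L (spos \<theta>))) has_real_derivative - rad \<theta> * sin \<theta>)
      (at \<theta> within {-pi..pi})"
    by (rule has_field_derivative_transform_within[OF _ zero_less_one assms])
      (simp add: gcurve_spos)
qed

text \<open>\<open>rad * q\<close> and \<open>rad\<^sup>2 * r + rad' * q\<close> are the first two \<open>\<theta>\<close>-derivatives of a function
  whose arc length derivatives are \<open>q\<close> and \<open>r\<close>.\<close>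

lemma W22_angle_bound:
  obtains K where "K > 0"
    "\<And>\<theta> p q r. \<theta> \<in> {-pi..pi} \<Longrightarrow> rad \<theta> * (p\<^sup>2 + q\<^sup>2 + r\<^sup>2)
      \<le> K * (p\<^sup>2 + (rad \<theta> * q)\<^sup>2 + ((rad \<theta>)\<^sup>2 * r + rad' \<theta> * q)\<^sup>2)"
proof -
  \<comment> \<open>The three summands are the coefficients of p^2, w^2 and v^2 below. All are
    nonnegative, so one bound for their continuous sum on the compact interval bounds each of
    them.\<close>
  define B where "B \<theta> = rad \<theta> + (1 / rad \<theta> + 2 * (rad' \<theta>)\<^sup>2 / rad \<theta> ^ 5) + 2 / rad \<theta> ^ 3" for \<theta>
  have "continuous_on {-pi..pi} B"
    unfolding B_def[abs_def] using rad_pos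
    by (intro continuous_intros continuous_angle_functions) (auto, (metis less_irrefl)+)
  then have "bounded (B ` {-pi..pi})"
    using compact_continuous_image compact_imp_bounded by blast
  then obtain K where "K > 0" "\<forall>\<theta>\<in>{-pi..pi}. \<bar>B \<theta>\<bar> \<le> K"
    unfolding bounded_pos by auto
  then have K: "K > 0" "\<And>\<theta>. \<theta> \<in> {-pi..pi} \<Longrightarrow> B \<theta> \<le> K"
    by (auto dest: abs_le_D1)
  show ?thesis
  proof (rule that[OF K(1)])
    fix \<theta> p q r assume \<theta>: "\<theta> \<in> {-pi..pi}"
    define w where "w = rad \<theta> * q"
    define v where "v = (rad \<theta>)\<^sup>2 * r + rad' \<theta> * q"
    have r: "rad \<theta> > 0" using rad_pos[OF \<theta>] .
    define z where "z = rad' \<theta> * q"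
    have "((rad \<theta>)\<^sup>2 * r)\<^sup>2 \<le> 2 * v\<^sup>2 + 2 * z\<^sup>2"
    proof -
      have "0 \<le> (v + z)\<^sup>2" by simp
      then show ?thesis by (simp add: v_def z_def power2_eq_square algebra_simps)
    qed
    then have "((rad \<theta>)\<^sup>2 * r)\<^sup>2 / rad \<theta> ^ 3 \<le> (2 * v\<^sup>2 + 2 * z\<^sup>2) / rad \<theta> ^ 3"
      using r by (intro divide_right_mono) auto
    moreover have "((rad \<theta>)\<^sup>2 * r)\<^sup>2 / rad \<theta> ^ 3 = rad \<theta> * r\<^sup>2"
      using r by (simp add: field_simps power_numeral_reduce)
    moreover have "(2 * v\<^sup>2 + 2 * z\<^sup>2) / rad \<theta> ^ 3
        = 2 / rad \<theta> ^ 3 * v\<^sup>2 + 2 * (rad' \<theta>)\<^sup>2 / rad \<theta> ^ 5 * w\<^sup>2"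
      using r by (simp add: z_def w_def field_simps power_numeral_reduce)
    moreover have "rad \<theta> * q\<^sup>2 = 1 / rad \<theta> * w\<^sup>2"
      using r by (simp add: w_def field_simps power_numeral_reduce)
    ultimately have "rad \<theta> * (p\<^sup>2 + q\<^sup>2 + r\<^sup>2) \<le> rad \<theta> * p\<^sup>2
        + (1 / rad \<theta> + 2 * (rad' \<theta>)\<^sup>2 / rad \<theta> ^ 5) * w\<^sup>2 + 2 / rad \<theta> ^ 3 * v\<^sup>2"
      by (simp add: distrib_left distrib_right)
    also have "\<dots> \<le> K * p\<^sup>2 + K * w\<^sup>2 + K * v\<^sup>2"
    proof -
      have "0 \<le> 1 / rad \<theta> + 2 * (rad' \<theta>)\<^sup>2 / rad \<theta> ^ 5" "0 \<le> 2 / rad \<theta> ^ 3"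
        using r by (auto intro!: add_nonneg_nonneg divide_nonneg_nonneg)
      then have "rad \<theta> \<le> K" "1 / rad \<theta> + 2 * (rad' \<theta>)\<^sup>2 / rad \<theta> ^ 5 \<le> K" "2 / rad \<theta> ^ 3 \<le> K"
        using K(2)[OF \<theta>] r unfolding B_def by linarith+
      then show ?thesis by (intro add_mono mult_right_mono) auto
    qed
    finally show "rad \<theta> * (p\<^sup>2 + q\<^sup>2 + r\<^sup>2)
        \<le> K * (p\<^sup>2 + (rad \<theta> * q)\<^sup>2 + ((rad \<theta>)\<^sup>2 * r + rad' \<theta> * q)\<^sup>2)"
      by (simp add: w_def v_def distrib_left)
  qed
qed

lemma integral_spos:
  fixes f :: "real \<Rightarrow> real"
  assumes "continuous_on {0..2*L} f"
  shows "integral {0..2*L} f = integral {-pi..pi} (\<lambda>\<theta>. rad \<theta> * f (spos \<theta>))"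
proof -
  have "((\<lambda>\<theta>. rad \<theta> *\<^sub>R f (spos \<theta>)) has_integral integral {spos (-pi)..spos pi} f) {-pi..pi}"
    by (rule has_integral_substitution[where c = 0 and d = "2 * L"])
      (use assms x0 L spos_range in \<open>auto simp: spos_ends intro: spos_deriv\<close>)
  then show ?thesis by (simp add: spos_ends integral_unique)
qed

end

section \<open>Coercivity of the second variation\<close>

text \<open>Meant for the ordinate of a competitor, which leaves the axis upwards: a negative
  derivative would push it below the axis immediately. The two-sided derivative comes from the
  smooth extension beyond the parameter interval.\<close>

lemma deriv_nonneg_at_left_end:
  fixes f :: "real \<Rightarrow> real"
  assumes "(f has_real_derivative l) (at a)" "a < b" "f a = 0"
    and "\<And>s. a < s \<Longrightarrow> s < b \<Longrightarrow> 0 < f s"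
  shows "0 \<le> l"
proof (rule ccontr)
  assume "\<not> 0 \<le> l"
  then obtain e where e: "e > 0" "\<And>h. 0 < h \<Longrightarrow> h < e \<Longrightarrow> f (a + h) < f a"
    using DERIV_neg_dec_right[OF assms(1)] by auto
  define h where "h = min e (b - a) / 2"
  have "0 < h" "h < e" "a + h < b" using e assms(2) by (auto simp: h_def min_def field_simps)
  then show False using e(2)[of h] assms(3) assms(4)[of "a + h"] by simp
qed

lemma deriv_nonpos_at_right_end:
  fixes f :: "real \<Rightarrow> real"
  assumes "(f has_real_derivative l) (at b)" "a < b" "f b = 0"
    and "\<And>s. a < s \<Longrightarrow> s < b \<Longrightarrow> 0 < f s"
  shows "l \<le> 0"
proof (rule ccontr)
  assume "\<not> l \<le> 0"
  then obtain e where e: "e > 0" "\<And>h. 0 < h \<Longrightarrow> h < e \<Longrightarrow> f (b - h) < f b"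
    using DERIV_pos_inc_left[OF assms(1)] by auto
  define h where "h = min e (b - a) / 2"
  have "0 < h" "h < e" "a < b - h" using e assms(2) by (auto simp: h_def min_def field_simps)
  then show False using e(2)[of h] assms(3) assms(4)[of "b - h"] by simp
qed

text \<open>If the integrand is not integrable, the integral is 0 by convention, so the bound holds
  for arbitrary \<open>f\<close>.\<close>

lemma W22_sq_nonneg: "0 \<le> W22_sq L f"
  unfolding W22_sq_def
  by (cases "(\<lambda>s. (f s)\<^sup>2 + (deriv f s)\<^sup>2 + (deriv (deriv f) s)\<^sup>2) integrable_on {0..2*L}")
    (auto intro!: integral_nonneg simp: not_integrable_integral)

text \<open>A variation is unconstrained outside the parameter interval, so the two-sided
  \<open>deriv\<close> carries no information at 0 and 2L. These two points form a null set and are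
  discarded.\<close>

lemma W22_sq_eq:
  fixes f f0 f1 f2 :: "real \<Rightarrow> real"
  assumes f: "\<And>s. s \<in> {0<..<2*L} \<Longrightarrow> f s = f0 s"
    and f0: "\<And>s. s \<in> {0<..<2*L} \<Longrightarrow> (f0 has_real_derivative f1 s) (at s)"
    and f1: "\<And>s. s \<in> {0<..<2*L} \<Longrightarrow> (f1 has_real_derivative f2 s) (at s)"
  shows "W22_sq L f = integral {0..2*L} (\<lambda>s. (f0 s)\<^sup>2 + (f1 s)\<^sup>2 + (f2 s)\<^sup>2)"
proof -
  have d: "deriv f s = f1 s" if "s \<in> {0<..<2*L}" for s
    by (rule DERIV_imp_deriv, rule has_field_derivative_transform_within_open[OF f0[OF that], of "{0<..<2*L}"])
      (use that f in auto)
  have dd: "deriv (deriv f) s = f2 s" if "s \<in> {0<..<2*L}" for s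
    by (rule DERIV_imp_deriv, rule has_field_derivative_transform_within_open[OF f1[OF that], of "{0<..<2*L}"])
      (use that d in auto)
  show ?thesis
    unfolding W22_sq_def
    by (rule integral_spike[where S = "{0, 2*L}"]) (auto simp: f d dd)
qed

text \<open>Both functions admit the same derivative candidates at each point, so the chosen values
  agree even where no derivative exists.\<close>

lemma deriv_add_const: "deriv (\<lambda>t. f t + c) = deriv (f :: real \<Rightarrow> real)"
proof -
  have "((\<lambda>t. f t + c) has_real_derivative l) (at t) \<longleftrightarrow> (f has_real_derivative l) (at t)" for l t
    using DERIV_add[of f l t UNIV "\<lambda>_. c" 0] DERIV_diff[of "\<lambda>t. f t + c" l t UNIV "\<lambda>_. c" 0] by auto
  then show ?thesis unfolding deriv_def by simp
qed

text \<open>For times near 0 the two functionals differ by the constant \<open>lam\<close> times the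
  fixed area, so their first derivatives agree near 0 and their second derivatives agree at
  0.\<close>

lemma second_var_area_preserving:
  assumes "admissible_variation x0 L \<gamma> t0 V" "area_preserving L \<gamma> t0 V"
  shows "second_var (Fcal L) V = second_var (\<lambda>c. Fcal L c - lam * area L c) V"
proof -
  define E where "E t = Fcal L (\<lambda>s. V s t) - lam * area L (\<lambda>s. V s t)" for t
  have t0: "t0 > 0" using assms(1) by (simp add: admissible_variation_def)
  have eq: "Fcal L (\<lambda>s. V s t) = E t + lam * area L \<gamma>" if "t \<in> {-t0<..<t0}" for t
    using assms(2) that by (simp add: E_def area_preserving_def)
  have d: "deriv (\<lambda>t. Fcal L (\<lambda>s. V s t)) t = deriv E t" if "t \<in> {-t0<..<t0}" for t
  proof -
    have "eventually (\<lambda>t. t \<in> {-t0<..<t0}) (nhds t)"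
      using that by (intro eventually_nhds_in_open) auto
    then have "deriv (\<lambda>t. Fcal L (\<lambda>s. V s t)) t = deriv (\<lambda>t. E t + lam * area L \<gamma>) t"
      by (intro deriv_cong_ev) (auto elim: eventually_mono simp: eq)
    then show ?thesis by (simp add: deriv_add_const)
  qed
  have "eventually (\<lambda>t. t \<in> {-t0<..<t0}) (nhds 0)"
    using t0 by (intro eventually_nhds_in_open) auto
  then have "deriv (deriv (\<lambda>t. Fcal L (\<lambda>s. V s t))) 0 = deriv (deriv E) 0"
    by (intro deriv_cong_ev) (auto elim: eventually_mono simp: d)
  then show ?thesis by (simp add: second_var_def E_def[abs_def])
qed

text \<open>The chain rule for \<open>f 0 j (spos \<theta>) t\<close>, where \<open>f i j\<close> is differentiated \<open>i\<close> times in arc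
  length and \<open>j\<close> times in \<open>t\<close>.\<close>

definition (in gamma_curve) angle_lift ::
    "(nat \<Rightarrow> nat \<Rightarrow> real \<Rightarrow> real \<Rightarrow> real) \<Rightarrow> nat \<Rightarrow> nat \<Rightarrow> real \<Rightarrow> real \<Rightarrow> real" where
  "angle_lift f i j \<theta> t =
    (if i = 0 then f 0 j (spos \<theta>) t else if i = 1 then rad \<theta> * f 1 j (spos \<theta>) t
     else (rad \<theta>)\<^sup>2 * f 2 j (spos \<theta>) t + rad' \<theta> * f 1 j (spos \<theta>) t)"

text \<open>Transfers the estimate from the tangent angle back to arc length. The first factor of
  the constant is that of the angle estimate; \<open>K\<close> pays for comparing the two Sobolev
  norms and does not depend on the variation.\<close>

lemma (in gamma_curve) second_variation_coercive:
  assumes V: "admissible_variation x0 L (gcurve x0 L) t0 V"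
    and K: "K > 0" "\<And>\<theta> p q r. \<theta> \<in> {-pi..pi} \<Longrightarrow> rad \<theta> * (p\<^sup>2 + q\<^sup>2 + r\<^sup>2)
      \<le> K * (p\<^sup>2 + (rad \<theta> * q)\<^sup>2 + ((rad \<theta>)\<^sup>2 * r + rad' \<theta> * q)\<^sup>2)"
  shows "second_var (\<lambda>c. Fcal L c - glambda x0 L * area L c) V
    \<ge> 2 * m\<^sup>2 / (2 + 6 * pi * exp (2 * pi)) / K * W22_sq L (normal_comp L (gcurve x0 L) V)"
proof -
  have L0: "0 < 2 * L" using x0 L by simp
  have t0: "t0 > 0" and smooth: "C_inf_on ({0..2*L} \<times> {-t0..t0}) (\<lambda>p. V (fst p) (snd p))"
    and V0: "\<And>s. s \<in> {0..2*L} \<Longrightarrow> V s 0 = gcurve x0 L s"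
    and adm: "\<And>t. t \<in> {-t0..t0} \<Longrightarrow> admissible x0 L (\<lambda>s. V s t)"
    using V by (auto simp: admissible_variation_def)
  obtain U A where U: "open U" "{0..2*L} \<times> {-t0..t0} \<subseteq> U"
    and A0: "\<And>p. p \<in> {0..2*L} \<times> {-t0..t0} \<Longrightarrow> A 0 0 (fst p) (snd p) = V (fst p) (snd p)"
    and As: "\<And>i j s t. (s, t) \<in> U \<Longrightarrow>
      ((\<lambda>s. A i j s t) has_vector_derivative A (Suc i) j s t) (at s)"
    and At: "\<And>i j s t. (s, t) \<in> U \<Longrightarrow> (A i j s has_vector_derivative A i (Suc j) s t) (at t)"
    and Ac: "\<And>i j. continuous_on U (\<lambda>(s, t). A i j s t)"
    using smooth by (rule C_inf_on_partials) blast
  have inU: "(s, t) \<in> U" if "s \<in> {0..2*L}" "t \<in> {-t0..t0}" for s t using U(2) that by blast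
  have AV: "A 0 0 s t = V s t" if "s \<in> {0..2*L}" "t \<in> {-t0..t0}" for s t
    using A0[of "(s, t)"] that by simp
  have A1: "((\<lambda>s. A 0 j s t) has_vector_derivative A 1 j s t) (at s)"
    and A2: "((\<lambda>s. A 1 j s t) has_vector_derivative A 2 j s t) (at s)" if "(s, t) \<in> U" for j s t
    using As[OF that, of 0 j] As[OF that, of 1 j] by (simp_all add: numeral_2_eq_2)
  define a where "a i j s t = fst (A i j s t)" for i j s t
  define b where "b i j s t = snd (A i j s t)" for i j s t
  have fs: "((\<lambda>s. f i j s t) has_real_derivative f (Suc i) j s t) (at s)"
    and ft: "(f i j s has_real_derivative f i (Suc j) s t) (at t)"
    if "f \<in> {a, b}" "(s, t) \<in> U" for f i j s t
    using that(1) As[OF that(2), of i j] At[OF that(2), of i j]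
    unfolding has_real_derivative_iff_has_vector_derivative a_def b_def
    by (auto intro: bounded_linear.has_vector_derivative[OF bounded_linear_fst]
        bounded_linear.has_vector_derivative[OF bounded_linear_snd])
  have fc: "continuous_on U (\<lambda>p. f i j (fst p) (snd p))" if "f \<in> {a, b}" for f i j
    using that Ac[of i j] unfolding a_def b_def
    by (auto simp: case_prod_unfold intro: continuous_on_fst continuous_on_snd)
  note as = fs[of a, simplified] and bs = fs[of b, simplified]

  \<comment> \<open>The energy as an integral over the arc length of the unperturbed curve\<close>
  have cdot: "cdot L (\<lambda>s. V s t) s = A 1 0 s t" if "s \<in> {0..2*L}" "t \<in> {-t0..t0}" for s t
    unfolding cdot_def
  proof (rule vector_derivative_within_closed_interval[OF L0 that(1)])
    show "((\<lambda>s. V s t) has_vector_derivative A 1 0 s t) (at s within {0..2*L})"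
      by (rule has_vector_derivative_transform[OF that(1) _
            has_vector_derivative_at_within[OF A1[OF inU[OF that]]]])
        (use AV that in auto)
  qed
  have cddot: "cddot L (\<lambda>s. V s t) s = A 2 0 s t" if "s \<in> {0..2*L}" "t \<in> {-t0..t0}" for s t
    unfolding cddot_def
  proof (rule vector_derivative_within_closed_interval[OF L0 that(1)])
    show "(cdot L (\<lambda>s. V s t) has_vector_derivative A 2 0 s t) (at s within {0..2*L})"
      by (rule has_vector_derivative_transform[OF that(1) _
            has_vector_derivative_at_within[OF A2[OF inU[OF that]]]])
        (use cdot that in auto)
  qed
  have nrm: "norm (A 1 0 s t) ^ 2 = (a 1 0 s t)\<^sup>2 + (b 1 0 s t)\<^sup>2" for s t
    by (simp add: a_def b_def norm_prod_def)
  define D where "D s t = a 1 0 s t * b 2 0 s t - b 1 0 s t * a 2 0 s t" for s t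
  have curv: "curvature L (\<lambda>s. V s t) s = D s t / norm (A 1 0 s t) ^ 3"
    if "s \<in> {0..2*L}" "t \<in> {-t0..t0}" for s t
    by (simp add: curvature_def cdot[OF that] cddot[OF that] perp_def D_def a_def b_def
        inner_prod_def)
  have npos: "norm (A 1 0 s t) > 0" and Dpos: "D s t > 0"
    if "s \<in> {0..2*L}" "t \<in> {-t0..t0}" for s t
  proof -
    show n: "norm (A 1 0 s t) > 0"
      using adm[OF that(2)] that(1) cdot[OF that] by (auto simp: admissible_def)
    have "curvature L (\<lambda>s. V s t) s > 0" using adm[OF that(2)] that by (simp add: admissible_def)
    then show "D s t > 0" using n curv[OF that] by (simp add: zero_less_divide_iff)
  qed
  define E where "E t = Fcal L (\<lambda>s. V s t) - glambda x0 L * area L (\<lambda>s. V s t)" for t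
  \<comment> \<open>Speed divided by curvature is |gamma'|^4 / det (gamma', gamma''), and lambda
    times the factor 1/2 of the area is 1 - m^2.\<close>
  define h where "h t s = ((a 1 0 s t)\<^sup>2 + (b 1 0 s t)\<^sup>2)\<^sup>2 / D s t
      - (1 - m\<^sup>2) * (a 0 0 s t * b 1 0 s t - a 1 0 s t * b 0 0 s t)" for t s
  have slice: "continuous_on {0..2*L} (\<lambda>s. f i j s t)" if "f \<in> {a, b}" "t \<in> {-t0..t0}" for f i j t
  proof -
    have "continuous_on {0..2*L} (\<lambda>s. (s, t))" "(\<lambda>s. (s, t)) ` {0..2*L} \<subseteq> U"
      using inU that by (auto intro!: continuous_intros)
    from continuous_on_compose2[OF fc[OF that(1)] this] show ?thesis by simp
  qed
  note sl = slice[OF insertI1] slice[OF insertI2[OF singletonI]]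
  have ch: "continuous_on {0..2*L} (h t)" if t: "t \<in> {-t0..t0}" for t
    unfolding h_def[abs_def] D_def using Dpos[OF _ t] t
    by (intro continuous_intros sl) (auto simp: D_def, (metis less_irrefl)+)
  have E: "E t = integral {-pi..pi} (\<lambda>\<theta>. rad \<theta> * h t (spos \<theta>))" if t: "t \<in> {-t0..t0}" for t
  proof -
    have 1: "Fcal L (\<lambda>s. V s t) = integral {0..2*L}
        (\<lambda>s. ((a 1 0 s t)\<^sup>2 + (b 1 0 s t)\<^sup>2)\<^sup>2 / D s t)"
      unfolding Fcal_def
    proof (rule integral_cong)
      fix s assume s: "s \<in> {0..2*L}"
      have "n / (d / n ^ 3) = (n\<^sup>2)\<^sup>2 / d" for n d :: real
        by (simp add: power_numeral_reduce)
      then show "norm (cdot L (\<lambda>s. V s t) s) / curvature L (\<lambda>s. V s t) s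
          = ((a 1 0 s t)\<^sup>2 + (b 1 0 s t)\<^sup>2)\<^sup>2 / D s t"
        by (simp only: cdot[OF s t] curv[OF s t] nrm)
    qed
    have 2: "area L (\<lambda>s. V s t) = 1/2 * integral {0..2*L}
        (\<lambda>s. a 0 0 s t * b 1 0 s t - a 1 0 s t * b 0 0 s t)"
      unfolding area_def
      by (intro arg_cong2[where f = "(*)"] refl integral_cong)
        (simp add: cdot[OF _ t] AV[OF _ t, symmetric] a_def b_def)
    have "(\<lambda>s. ((a 1 0 s t)\<^sup>2 + (b 1 0 s t)\<^sup>2)\<^sup>2 / D s t) integrable_on {0..2*L}"
      unfolding D_def using Dpos[OF _ t] t
      by (intro integrable_continuous_real continuous_intros sl) (auto simp: D_def, (metis less_irrefl)+)
    moreover have "(\<lambda>s. (1 - m\<^sup>2) * (a 0 0 s t * b 1 0 s t - a 1 0 s t * b 0 0 s t))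
        integrable_on {0..2*L}"
      by (intro integrable_continuous_real continuous_intros sl t)
    ultimately have "E t = integral {0..2*L} (h t)"
      unfolding E_def 1 2 lambda h_def[abs_def] by (subst integral_diff) simp_all
    then show ?thesis using integral_spos[OF ch[OF t]] by simp
  qed

  \<comment> \<open>Passage from arc length to the tangent angle\<close>
  let ?I = "{-pi..pi}"
  define x where "x = angle_lift a"
  define y where "y = angle_lift b"
  have lift: "z \<in> {x, y} \<Longrightarrow> \<exists>f\<in>{a, b}. z = angle_lift f" for z by (auto simp: x_def y_def)
  have sU: "(spos \<theta>, t) \<in> U" if "\<theta> \<in> ?I" "t \<in> {-t0<..<t0}" for \<theta> t
    using spos_range[OF that(1)] that(2) by (intro inU) auto
  have pm: "-pi \<in> ?I" "pi \<in> ?I" by auto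
  have fspos: "((\<lambda>\<theta>. f i j (spos \<theta>) 0) has_real_derivative f (Suc i) j (spos \<theta>) 0 * rad \<theta>)
      (at \<theta> within ?I)" if "f \<in> {a, b}" "\<theta> \<in> ?I" for f i j \<theta>
    by (rule DERIV_chain2[OF fs[OF that(1)] spos_deriv]) (use sU that t0 in auto)
  have dang: "((\<lambda>\<theta>. angle_lift f i j \<theta> 0) has_real_derivative angle_lift f (Suc i) j \<theta> 0)
      (at \<theta> within ?I)" if f: "f \<in> {a, b}" and i: "i \<le> 1" and \<theta>: "\<theta> \<in> ?I" for f i j \<theta>
  proof (cases "i = 0")
    case True
    then show ?thesis using fspos[OF f \<theta>, of 0 j] by (simp add: angle_lift_def mult.commute)
  next
    case False
    then have [simp]: "i = 1" using i by simp
    have "((\<lambda>\<theta>. rad \<theta> * f 1 j (spos \<theta>) 0) has_real_derivative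
        rad' \<theta> * f 1 j (spos \<theta>) 0 + f (Suc 1) j (spos \<theta>) 0 * rad \<theta> * rad \<theta>) (at \<theta> within ?I)"
      by (rule DERIV_mult[OF rad_deriv fspos[OF f \<theta>]])
    then show ?thesis
      by (simp add: angle_lift_def power2_eq_square numeral_2_eq_2 algebra_simps)
  qed
  have xy_tangent: "x 1 0 \<theta> 0 = - rad \<theta> * cos \<theta>" "y 1 0 \<theta> 0 = - rad \<theta> * sin \<theta>"
    if \<theta>: "\<theta> \<in> ?I" for \<theta>
  proof -
    have uniq: "f' = f''" if "(f has_real_derivative f') (at \<theta> within ?I)"
      "(f has_real_derivative f'') (at \<theta> within ?I)" for f :: "real \<Rightarrow> real" and f' f''
      using vector_derivative_unique_within_closed_interval[of "-pi" pi \<theta> f f' f''] that \<theta>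
      by (simp add: has_real_derivative_iff_has_vector_derivative)
    have g: "x 0 0 \<eta> 0 = fst (gcurve x0 L (spos \<eta>))" "y 0 0 \<eta> 0 = snd (gcurve x0 L (spos \<eta>))"
      if "\<eta> \<in> ?I" for \<eta>
      using spos_range[OF that] t0
      by (simp_all add: x_def y_def angle_lift_def a_def b_def AV V0)
    have "((\<lambda>\<theta>. x 0 0 \<theta> 0) has_real_derivative - rad \<theta> * cos \<theta>) (at \<theta> within ?I)"
      by (rule has_field_derivative_transform_within[OF gcurve_spos_deriv(1)[OF \<theta>] zero_less_one \<theta>])
        (use g in auto)
    moreover have "((\<lambda>\<theta>. x 0 0 \<theta> 0) has_real_derivative x 1 0 \<theta> 0) (at \<theta> within ?I)"
      using dang[of a 0 \<theta> 0] \<theta> by (simp add: x_def)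
    ultimately show "x 1 0 \<theta> 0 = - rad \<theta> * cos \<theta>" using uniq by blast
    have "((\<lambda>\<theta>. y 0 0 \<theta> 0) has_real_derivative - rad \<theta> * sin \<theta>) (at \<theta> within ?I)"
      by (rule has_field_derivative_transform_within[OF gcurve_spos_deriv(2)[OF \<theta>] zero_less_one \<theta>])
        (use g in auto)
    moreover have "((\<lambda>\<theta>. y 0 0 \<theta> 0) has_real_derivative y 1 0 \<theta> 0) (at \<theta> within ?I)"
      using dang[of b 0 \<theta> 0] \<theta> by (simp add: y_def)
    ultimately show "y 1 0 \<theta> 0 = - rad \<theta> * sin \<theta>" using uniq by blast
  qed
  have tang: "a 1 0 (spos \<theta>) 0 = - cos \<theta>" "b 1 0 (spos \<theta>) 0 = - sin \<theta>" if "\<theta> \<in> ?I" for \<theta>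
  proof -
    have "rad \<theta> * a 1 0 (spos \<theta>) 0 = rad \<theta> * - cos \<theta>" "rad \<theta> * b 1 0 (spos \<theta>) 0 = rad \<theta> * - sin \<theta>"
      using xy_tangent[OF that] by (simp_all add: x_def y_def angle_lift_def)
    then show "a 1 0 (spos \<theta>) 0 = - cos \<theta>" "b 1 0 (spos \<theta>) 0 = - sin \<theta>"
      using rad_pos[OF that] unfolding mult_cancel_left by auto
  qed

  \<comment> \<open>Conditions at the fixed end points\<close>
  have fixed: "f 0 j s 0 = 0" if f: "f \<in> {a, b}" and s: "s \<in> {0, 2*L}" and j: "j \<in> {1, 2}" for f s j
  proof -
    have s': "s \<in> {0..2*L}" using s L0 by auto
    have "f 0 0 s t = f 0 0 s 0" if "t \<in> {-t0<..<t0}" for t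
    proof -
      have "V s t = V s 0"
        using adm[of t] adm[of 0] that t0 s by (auto simp: admissible_def)
      then show ?thesis using f AV[OF s', of t] AV[OF s', of 0] that t0
        by (auto simp: a_def b_def)
    qed
    note const = this
    have zero: "f 0 (Suc j) s t = 0"
      if "\<And>t. t \<in> {-t0<..<t0} \<Longrightarrow> f 0 j s t = c" "t \<in> {-t0<..<t0}" for j t c
    proof -
      have "(f 0 j s has_real_derivative f 0 (Suc j) s t) (at t)"
        by (rule ft[OF f inU[OF s']]) (use that in auto)
      moreover have "(f 0 j s has_real_derivative 0) (at t)"
        by (rule has_field_derivative_transform_within_open[OF DERIV_const[of c], where S = "{-t0<..<t0}"])
          (use that in auto)
      ultimately show ?thesis by (rule DERIV_unique)
    qed
    have z1: "f 0 1 s t = 0" if "t \<in> {-t0<..<t0}" for t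
      using zero[of 0, OF const that] by simp
    have "f 0 2 s 0 = 0"
      using zero[of 1 0 0] z1 t0 by (simp add: numeral_2_eq_2)
    then show ?thesis using j z1[of 0] t0 by auto
  qed
  have b0: "b 0 0 s t = 0" if "s \<in> {0, 2*L}" "t \<in> {-t0..t0}" for s t
    using adm[OF that(2)] AV[of s t] that L0 by (auto simp: b_def admissible_def)
  have bpos: "b 0 0 s t > 0" if "0 < s" "s < 2*L" "t \<in> {-t0..t0}" for s t
    using adm[OF that(3)] AV[of s t] that by (auto simp: b_def admissible_def)
  have b1_left: "0 \<le> b 1 0 0 t" if "t \<in> {-t0..t0}" for t
    by (rule deriv_nonneg_at_left_end[of "\<lambda>s. b 0 0 s t" _ 0 "2 * L"])
      (use bs[OF inU, of 0 t 0 0] b0 bpos L0 that in auto)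
  have b1_right: "b 1 0 (2*L) t \<le> 0" if "t \<in> {-t0..t0}" for t
    by (rule deriv_nonpos_at_right_end[of "\<lambda>s. b 0 0 s t" _ "2 * L" 0])
      (use bs[OF inU, of "2*L" t 0 0] b0 bpos L0 that in auto)
  have b1_0: "b 1 0 0 0 = 0" "b 1 0 (2*L) 0 = 0"
    using tang(2)[OF pm(1)] tang(2)[OF pm(2)] by (simp_all add: spos_ends)
  have bt: "(b i j s has_real_derivative b i (Suc j) s t) (at t)"
    if "s \<in> {0, 2*L}" "t \<in> {-t0<..<t0}" for i j s t
    by (rule ft[of b, OF _ inU]) (use that L0 in auto)
  \<comment> \<open>The end slope is nonnegative for all times and vanishes at time 0, where the
    tangent is horizontal. Time 0 is thus a minimum: the first derivative clamps the normal velocity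
    and the second one signs the boundary term. The right end is the mirror image.\<close>
  have left: "b 1 1 0 0 = 0" "0 \<le> b 1 2 0 0"
    using boundary_second_derivative_nonneg[OF t0, of "b 1 0 0" "b 1 1 0" "b 1 2 0 0"]
      bt[of 0 _ 1 0] bt[of 0 0 1 1] b1_left b1_0 t0 by (auto simp: numeral_2_eq_2)
  have right: "b 1 1 (2*L) 0 = 0" "b 1 2 (2*L) 0 \<le> 0"
    using boundary_second_derivative_nonneg[OF t0, of "\<lambda>t. - b 1 0 (2*L) t"
        "\<lambda>t. - b 1 1 (2*L) t" "- b 1 2 (2*L) 0"]
      bt[of "2*L" _ 1 0] bt[of "2*L" 0 1 1] b1_right b1_0 t0
    by (auto simp: numeral_2_eq_2 intro!: DERIV_minus)

  \<comment> \<open>The normal velocity and its Sobolev norm\<close>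
  define n0 where "n0 s = a 0 1 s 0 * b 1 0 s 0 - b 0 1 s 0 * a 1 0 s 0" for s
  define n1 where "n1 s = a 1 1 s 0 * b 1 0 s 0 + a 0 1 s 0 * b 2 0 s 0
      - b 1 1 s 0 * a 1 0 s 0 - b 0 1 s 0 * a 2 0 s 0" for s
  define n2 where "n2 s = a 2 1 s 0 * b 1 0 s 0 + 2 * a 1 1 s 0 * b 2 0 s 0
      + a 0 1 s 0 * b 3 0 s 0 - b 2 1 s 0 * a 1 0 s 0 - 2 * b 1 1 s 0 * a 2 0 s 0
      - b 0 1 s 0 * a 3 0 s 0" for s
  have z: "0 \<in> {-t0..t0}" using t0 by simp
  \<comment> \<open>\<open>n0\<close> is built from the smooth extension, so it has two-sided
    derivatives even at the ends, where \<open>normal_comp\<close> may not.\<close>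
  have dn0: "(n0 has_real_derivative n1 s) (at s)" if "s \<in> {0..2*L}" for s
    unfolding n0_def[abs_def] n1_def
    by (rule derivative_eq_intros as bs inU[OF that z] refl)+
      (simp add: numeral_2_eq_2 algebra_simps)
  have dn1: "(n1 has_real_derivative n2 s) (at s)" if "s \<in> {0..2*L}" for s
    unfolding n1_def[abs_def] n2_def
    by (rule derivative_eq_intros as bs inU[OF that z] refl)+
      (simp add: numeral_2_eq_2 numeral_3_eq_3 algebra_simps)
  have cn: "continuous_on {0..2*L} n0" "continuous_on {0..2*L} n1" "continuous_on {0..2*L} n2"
    unfolding n0_def[abs_def] n1_def[abs_def] n2_def[abs_def]
    by (intro continuous_intros sl z)+
  have unit: "norm (A 1 0 s 0) = 1" if s: "s \<in> {0..2*L}" for s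
  proof -
    obtain \<theta> where \<theta>: "\<theta> \<in> ?I" "s = spos \<theta>" using spos_surj[OF s] .
    have "norm (A 1 0 s 0) ^ 2 = 1" unfolding nrm \<theta>(2) tang[OF \<theta>(1)] by simp
    then show ?thesis by (simp add: power2_eq_1_iff) (smt (verit) norm_ge_zero)
  qed
  have ncomp: "normal_comp L (gcurve x0 L) V s = n0 s" if s: "s \<in> {0..2*L}" for s
  proof -
    have "velocity V s = A 0 1 s 0"
      unfolding velocity_def
    proof (rule vector_derivative_at)
      show "(V s has_vector_derivative A 0 1 s 0) (at 0)"
        by (rule has_vector_derivative_transform_within_open[where S = "{-t0<..<t0}"
              and f = "A 0 0 s"])
          (use At[OF inU[OF s z], of 0 0] t0 AV s in auto)
    qed
    moreover have "cdot L (gcurve x0 L) s = A 1 0 s 0"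
    proof -
      have "cdot L (gcurve x0 L) s = cdot L (\<lambda>s. V s 0) s"
        unfolding cdot_def
        by (rule vector_derivative_cong_eq) (use V0 s in \<open>auto simp: eventually_at_filter\<close>)
      then show ?thesis using cdot[OF s z] by simp
    qed
    ultimately show ?thesis
      unfolding normal_comp_def normal_def using unit[OF s]
      by (simp add: perp_def inner_prod_def n0_def a_def b_def)
  qed
  have W: "W22_sq L (normal_comp L (gcurve x0 L) V)
      = integral ?I (\<lambda>\<theta>. rad \<theta> * ((n0 (spos \<theta>))\<^sup>2 + (n1 (spos \<theta>))\<^sup>2 + (n2 (spos \<theta>))\<^sup>2))"
    by (subst W22_sq_eq[of L _ n0 n1 n2])
      (use ncomp dn0 dn1 in \<open>auto intro!: integral_spos continuous_intros cn\<close>)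

  define u where "u \<theta> = n0 (spos \<theta>)" for \<theta>
  define u1 where "u1 \<theta> = rad \<theta> * n1 (spos \<theta>)" for \<theta>
  define u2 where "u2 \<theta> = (rad \<theta>)\<^sup>2 * n2 (spos \<theta>) + rad' \<theta> * n1 (spos \<theta>)" for \<theta>
  have du: "(u has_real_derivative u1 \<theta>) (at \<theta> within ?I)" if "\<theta> \<in> ?I" for \<theta>
    using DERIV_chain2[OF dn0[OF spos_range[OF that]] spos_deriv]
    by (simp add: u_def[abs_def] u1_def mult.commute)
  have du1: "(u1 has_real_derivative u2 \<theta>) (at \<theta> within ?I)" if "\<theta> \<in> ?I" for \<theta>
    using DERIV_mult[OF rad_deriv DERIV_chain2[OF dn1[OF spos_range[OF that]] spos_deriv]]
    by (simp add: u1_def[abs_def] u2_def power2_eq_square algebra_simps)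
  have cs: "continuous_on ?I (\<lambda>\<theta>. f (spos \<theta>))" if "continuous_on {0..2*L} f"
    for f :: "real \<Rightarrow> real"
    by (rule continuous_on_compose2[OF that continuous_angle_functions(1)])
      (use spos_range in auto)
  note cns = cs[OF cn(1)] cs[OF cn(2)] cs[OF cn(3)] continuous_angle_functions

  \<comment> \<open>Application of the estimate in the tangent angle\<close>
  have main: "2 * m\<^sup>2 / (2 + 6 * pi * exp (2 * pi)) *
      integral ?I (\<lambda>\<theta>. (u \<theta>)\<^sup>2 + (u1 \<theta>)\<^sup>2 + (u2 \<theta>)\<^sup>2) \<le> deriv (deriv E) 0"
  proof (rule second_variation_angle_coercive[OF t0, where x = x and y = y and \<rho> = rad and R = rad'])
    fix z i j \<theta> t
    assume zi: "z \<in> {x, y}" "i \<le> (2::nat)" and \<theta>: "\<theta> \<in> ?I" and t: "t \<in> {-t0<..<t0}"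
    obtain f where f: "f \<in> {a, b}" and [simp]: "z = angle_lift f" using lift[OF zi(1)] by blast
    note d = ft[OF f sU[OF \<theta> t]]
    consider "i = 0" | "i = 1" | "i = 2" using zi(2) by linarith
    then show "(z i j \<theta> has_real_derivative z i (Suc j) \<theta> t) (at t)"
      by cases (auto simp: angle_lift_def[abs_def] intro!: derivative_eq_intros d[simplified])
  next
    fix z i j \<theta> assume zi: "z \<in> {x, y}" "i \<le> (1::nat)" and \<theta>: "\<theta> \<in> ?I"
    then show "((\<lambda>\<theta>. z i j \<theta> 0) has_real_derivative z (Suc i) j \<theta> 0) (at \<theta> within ?I)"
      using lift[OF zi(1)] dang by blast
  next
    fix z i j assume zi: "z \<in> {x, y}" "i \<le> (2::nat)"
    obtain f where f: "f \<in> {a, b}" and [simp]: "z = angle_lift f" using lift[OF zi(1)] by blast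
    have c: "continuous_on ({-t0<..<t0} \<times> ?I) (\<lambda>p. f i j (spos (snd p)) (fst p))" for i j
    proof -
      have "continuous_on ({-t0<..<t0} \<times> ?I) (\<lambda>p. (spos (snd p), fst p))"
        by (intro continuous_intros continuous_on_compose2[OF continuous_angle_functions(1)]) auto
      moreover have "(\<lambda>p. (spos (snd p), fst p)) ` ({-t0<..<t0} \<times> ?I) \<subseteq> U"
        using sU by auto
      ultimately show ?thesis using continuous_on_compose2[OF fc[OF f]] by fastforce
    qed
    have r: "continuous_on ({-t0<..<t0} \<times> ?I) (\<lambda>p. rad (snd p))"
      "continuous_on ({-t0<..<t0} \<times> ?I) (\<lambda>p. rad' (snd p))"
      by (rule continuous_on_compose2[OF continuous_angle_functions(2)]
          continuous_on_compose2[OF continuous_angle_functions(3)];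
          auto intro!: continuous_intros)+
    show "continuous_on ({-t0<..<t0} \<times> ?I) (\<lambda>p. z i j (snd p) (fst p))"
      unfolding \<open>z = angle_lift f\<close> angle_lift_def
      by (cases "i = 0"; cases "i = 1") (auto intro!: continuous_intros c r simp flip: One_nat_def)
  next
    fix \<theta> t assume \<theta>: "\<theta> \<in> ?I" and t: "t \<in> {-t0<..<t0}"
    have "x 1 0 \<theta> t * y 2 0 \<theta> t - y 1 0 \<theta> t * x 2 0 \<theta> t = rad \<theta> ^ 3 * D (spos \<theta>) t"
      by (simp add: x_def y_def angle_lift_def D_def power_numeral_reduce algebra_simps)
    moreover have "D (spos \<theta>) t > 0" using Dpos[OF spos_range[OF \<theta>]] t by simp
    ultimately show "x 1 0 \<theta> t * y 2 0 \<theta> t - y 1 0 \<theta> t * x 2 0 \<theta> t > 0"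
      using rad_pos[OF \<theta>] by simp
  next
    fix t assume t: "t \<in> {-t0<..<t0}"
    then have "E t = integral ?I (\<lambda>\<theta>. rad \<theta> * h t (spos \<theta>))" by (intro E) auto
    also have "\<dots> = integral ?I (\<lambda>\<theta>.
        ((x 1 0 \<theta> t)\<^sup>2 + (y 1 0 \<theta> t)\<^sup>2)\<^sup>2 / (x 1 0 \<theta> t * y 2 0 \<theta> t - y 1 0 \<theta> t * x 2 0 \<theta> t)
        - (1 - m\<^sup>2) * (x 0 0 \<theta> t * y 1 0 \<theta> t - x 1 0 \<theta> t * y 0 0 \<theta> t))"
    proof (rule integral_cong)
      fix \<theta> assume \<theta>: "\<theta> \<in> ?I"
      have r: "rad \<theta> > 0" by (rule rad_pos[OF \<theta>])
      \<comment> \<open>Reparametrisation invariance: the \<open>rad'\<close> terms cancel in the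
        determinant, which scales by rho^3 against rho^4 in the numerator. The quotient and the area
        density thus both acquire the single factor rho of the substitution.\<close>
      have "x 1 0 \<theta> t * y 2 0 \<theta> t - y 1 0 \<theta> t * x 2 0 \<theta> t = rad \<theta> ^ 3 * D (spos \<theta>) t"
        by (simp add: x_def y_def angle_lift_def D_def power_numeral_reduce algebra_simps)
      moreover have "((x 1 0 \<theta> t)\<^sup>2 + (y 1 0 \<theta> t)\<^sup>2)\<^sup>2
          = rad \<theta> ^ 4 * ((a 1 0 (spos \<theta>) t)\<^sup>2 + (b 1 0 (spos \<theta>) t)\<^sup>2)\<^sup>2"
        by (simp add: x_def y_def angle_lift_def power_mult_distrib distrib_left[symmetric])
      moreover have "rad \<theta> ^ 4 * g / (rad \<theta> ^ 3 * g') = rad \<theta> * (g / g')" for g g'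
        using r by (simp add: power_numeral_reduce)
      moreover have "x 0 0 \<theta> t * y 1 0 \<theta> t - x 1 0 \<theta> t * y 0 0 \<theta> t = rad \<theta> *
          (a 0 0 (spos \<theta>) t * b 1 0 (spos \<theta>) t - a 1 0 (spos \<theta>) t * b 0 0 (spos \<theta>) t)"
        by (simp add: x_def y_def angle_lift_def algebra_simps)
      ultimately show "rad \<theta> * h t (spos \<theta>) =
        ((x 1 0 \<theta> t)\<^sup>2 + (y 1 0 \<theta> t)\<^sup>2)\<^sup>2 / (x 1 0 \<theta> t * y 2 0 \<theta> t - y 1 0 \<theta> t * x 2 0 \<theta> t)
        - (1 - m\<^sup>2) * (x 0 0 \<theta> t * y 1 0 \<theta> t - x 1 0 \<theta> t * y 0 0 \<theta> t)"
        by (simp add: h_def right_diff_distrib)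
    qed
    finally show "E t = integral ?I (\<lambda>\<theta>.
        ((x 1 0 \<theta> t)\<^sup>2 + (y 1 0 \<theta> t)\<^sup>2)\<^sup>2 / (x 1 0 \<theta> t * y 2 0 \<theta> t - y 1 0 \<theta> t * x 2 0 \<theta> t)
        - (1 - m\<^sup>2) * (x 0 0 \<theta> t * y 1 0 \<theta> t - x 1 0 \<theta> t * y 0 0 \<theta> t))" .
  next
    fix z j \<theta> assume zj: "z \<in> {x, y}" "\<theta> \<in> {-pi, pi}" "j \<in> {1, 2::nat}"
    have "spos \<theta> \<in> {0, 2*L}" using zj(2) by (auto simp: spos_ends)
    then show "z 0 j \<theta> 0 = 0" using lift[OF zj(1)] fixed zj(3) by (auto simp: angle_lift_def)
  next
    show "y 1 1 (-pi) 0 = 0" "y 1 1 pi 0 = 0"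
      using left right by (simp_all add: y_def angle_lift_def spos_ends)
    show "y 1 2 (-pi) 0 \<ge> 0" "y 1 2 pi 0 \<le> 0"
      using left(2) right(2) rad_pos[OF pm(1)] rad_pos[OF pm(2)]
      by (simp_all add: y_def angle_lift_def spos_ends mult_nonneg_nonpos)
  next
    fix \<theta> assume \<theta>: "\<theta> \<in> ?I"
    show "u \<theta> = - sin \<theta> * x 0 1 \<theta> 0 + cos \<theta> * y 0 1 \<theta> 0"
      using tang[OF \<theta>] by (simp add: u_def n0_def x_def y_def angle_lift_def)
  qed (use m_pos m_less xy_tangent rad_pos rad_deriv rad'_deriv du du1 in \<open>auto simp: less_imp_le\<close>)
  have "W22_sq L (normal_comp L (gcurve x0 L) V)
      \<le> integral ?I (\<lambda>\<theta>. K * ((u \<theta>)\<^sup>2 + (u1 \<theta>)\<^sup>2 + (u2 \<theta>)\<^sup>2))"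
    unfolding W
  proof (rule integral_le)
    show "rad \<theta> * ((n0 (spos \<theta>))\<^sup>2 + (n1 (spos \<theta>))\<^sup>2 + (n2 (spos \<theta>))\<^sup>2)
        \<le> K * ((u \<theta>)\<^sup>2 + (u1 \<theta>)\<^sup>2 + (u2 \<theta>)\<^sup>2)" if "\<theta> \<in> ?I" for \<theta>
      using K(2)[OF that] by (simp add: u_def u1_def u2_def)
  qed (auto simp: u_def u1_def u2_def intro!: integrable_continuous_real continuous_intros cns)
  then have "W22_sq L (normal_comp L (gcurve x0 L) V) / K
      \<le> integral ?I (\<lambda>\<theta>. (u \<theta>)\<^sup>2 + (u1 \<theta>)\<^sup>2 + (u2 \<theta>)\<^sup>2)"
    using K(1) by (simp add: divide_le_eq mult.commute del: distrib_left_numeral)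
  then have "2 * m\<^sup>2 / (2 + 6 * pi * exp (2 * pi)) *
      (W22_sq L (normal_comp L (gcurve x0 L) V) / K) \<le> 2 * m\<^sup>2 / (2 + 6 * pi * exp (2 * pi)) *
      integral ?I (\<lambda>\<theta>. (u \<theta>)\<^sup>2 + (u1 \<theta>)\<^sup>2 + (u2 \<theta>)\<^sup>2)"
    by (intro mult_left_mono) (auto intro!: divide_nonneg_nonneg add_nonneg_nonneg)
  also note main
  finally show ?thesis by (simp add: second_var_def E_def[abs_def])
qed

theorem mainTheorem1:
  fixes x0 A0 L :: real
  assumes "x0 > 0"
    and "A0 > 3/2 * pi * x0\<^sup>2"
    and "L > 3 * x0"
    and "area L (gcurve x0 L) = A0"
  shows "\<exists>C>0.
     (\<forall>t0 V. admissible_variation x0 L (gcurve x0 L) t0 V \<longrightarrow>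
        second_var (\<lambda>c. Fcal L c - glambda x0 L * area L c) V
          \<ge> C * W22_sq L (normal_comp L (gcurve x0 L) V)) \<and>
     stable_crit x0 L (gcurve x0 L) (glambda x0 L) \<and>
     (\<forall>t0 V. admissible_variation x0 L (gcurve x0 L) t0 V \<longrightarrow>
        area_preserving L (gcurve x0 L) t0 V \<longrightarrow>
        second_var (Fcal L) V \<ge> C * W22_sq L (normal_comp L (gcurve x0 L) V)) \<and>
     area_pres_stable x0 L (gcurve x0 L)"
proof -
  interpret gamma_curve x0 L using assms by unfold_locales
  obtain K where K: "K > 0"
    "\<And>\<theta> p q r. \<theta> \<in> {-pi..pi} \<Longrightarrow> rad \<theta> * (p\<^sup>2 + q\<^sup>2 + r\<^sup>2)
      \<le> K * (p\<^sup>2 + (rad \<theta> * q)\<^sup>2 + ((rad \<theta>)\<^sup>2 * r + rad' \<theta> * q)\<^sup>2)"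
    using W22_angle_bound by blast
  \<comment> \<open>Both \<open>m\<close> and \<open>K\<close> are determined before any variation
    is chosen, so one constant serves all variations in both inequalities.\<close>
  define C where "C = 2 * m\<^sup>2 / (2 + 6 * pi * exp (2 * pi)) / K"
  have C: "C > 0" unfolding C_def using m_pos K(1)
    by (intro divide_pos_pos add_pos_pos mult_pos_pos) auto
  have ii: "second_var (\<lambda>c. Fcal L c - glambda x0 L * area L c) V
      \<ge> C * W22_sq L (normal_comp L (gcurve x0 L) V)"
    if "admissible_variation x0 L (gcurve x0 L) t0 V" for t0 V
    unfolding C_def by (rule second_variation_coercive[OF that K])
  have iii: "second_var (Fcal L) V \<ge> C * W22_sq L (normal_comp L (gcurve x0 L) V)"
    if "admissible_variation x0 L (gcurve x0 L) t0 V" "area_preserving L (gcurve x0 L) t0 V" for t0 V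
    using ii[OF that(1)] second_var_area_preserving[OF that, of "glambda x0 L"] by simp
  have W: "0 \<le> C * W22_sq L f" for f using C W22_sq_nonneg by simp
  show ?thesis
    unfolding stable_crit_def area_pres_stable_def
    using C ii iii order_trans[OF W ii] order_trans[OF W iii] by blast
qed

end
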